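(* Let $\boldsymbol{\mathcal{A}}=(\mathcal{A}_0,\dots,\mathcal{A}_n)$ be a family of nonempty finite subsets of a lattice $M$ of rank $n$, let $\boldsymbol{\rho}=(\rho_0,\dots,\rho_n)$ be a family of convex piecewise affine functions $\rho_i\colon\Delta_i\to\mathbb{R}$ defined on $\mathcal{A}_i$, with $\Delta_i=\operatorname{conv}(\mathcal{A}_i)$, whose inf-convolution $\rho$ induces a tight mixed subdivision $S(\rho)$ of $\Delta=\sum_i\Delta_i$, and let $\delta\in M_{\mathbb{R}}$ be generic with respect to $S(\rho)$. Let $\phi_i\colon\Delta_i\to\mathbb{R}$, $i=0,\dots,n$, be another family of convex piecewise affine functions with inf-convolution $\phi$, and suppose that $S(\phi)\preceq S(\rho)$. Set $\boldsymbol{\omega}=(\phi_i(a))_{i\in\{0,\dots,n\},a\in\mathcal{A}_i}\in\mathbb{R}^{\boldsymbol{\mathcal{A}}}$ and let $\mathcal{C}\subset\mathcal{B}$ be a subset of the index set $\mathcal{B}=(\Delta+\delta)\cap M$. Then $$\operatorname{ord}_{\boldsymbol{\omega}}(H_{\boldsymbol{\mathcal{A}},\boldsymbol{\rho},\mathcal{C}})=\sum_{b\in\mathcal{C}}\phi_{i(b)}(a(b))\quad\text{and}\quad\operatorname{init}_{\boldsymbol{\omega}}(H_{\boldsymbol{\mathcal{A}},\boldsymbol{\rho},\mathcal{C}})=\prod_{D}H_{\boldsymbol{\mathcal{A}}_D,\boldsymbol{\rho}_D,\mathcal{C}_D},$$ the product being over the $n$-cells $D$ of $S(\phi)$.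
   Context: Polyhedral notation. $M\simeq\mathbb{Z}^n$, $N=\operatorname{Hom}(M,\mathbb{Z})$, $M_{\mathbb{R}}=M\otimes\mathbb{R}$, $N_{\mathbb{R}}=N\otimes\mathbb{R}$. For a convex piecewise affine function $\rho\colon\Delta\to\mathbb{R}$ on a polytope and $v\in N_{\mathbb{R}}$ put $\Gamma(\rho,v)=\{x\in\Delta\mid \rho(x)+\langle v,x\rangle=\min_{y\in\Delta}(\rho(y)+\langle v,y\rangle)\}$. The subdivision $S(\rho)$ of $\Delta$ is the collection of all the sets $\Gamma(\rho,v)$, called cells; an $n$-cell is a cell of dimension $n$. The inf-convolution of $\rho_i\colon\Delta_i\to\mathbb{R}$, $i=0,\dots,n$, is $\rho=\boxplus_i\rho_i\colon\Delta=\sum_i\Delta_i\to\mathbb{R}$, $\rho(x)=\inf\{\sum_i\rho_i(x_i)\mid x_i\in\Delta_i,\sum_ix_i=x\}$, and $S(\rho)$ is called a mixed subdivision of $\Delta$. The $i$-th component of $C\in S(\rho)$ is the set $C_i$ of $x_i\in\Delta_i$ for which there are $x_j\in\Delta_j$, $j\ne i$, with $\sum_jx_j\in C$ and $\rho(\sum_jx_j)=\sum_j\rho_j(x_j)$; if $C=\Gamma(\rho,v)$ then $C_i=\Gamma(\rho_i,v)$. $S(\rho)$ is tight if $\sum_{i}\dim(C_i)=n$ for every $n$-cell $C$. One writes $S(\phi)\preceq S(\rho)$ if for every $C\in S(\rho)$ there is $D\in S(\phi)$ with $C\subset D$ and $C_i\subset D_i$ for all $i$. The function $\rho_i$ is defined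 on $\mathcal{A}_i$ if there is $\boldsymbol{\nu}_i\in\mathbb{R}^{\mathcal{A}_i}$ such that $\rho_i(x)=\min\{z\mid(x,z)\in\operatorname{conv}\{(a,\nu_{i,a})\}_{a\in\mathcal{A}_i}\}$ for all $x\in\Delta_i$. Genericity of $\delta$: $(|S(\rho)^{n-1}|+\delta)\cap M=\emptyset$, where $|S(\rho)^{n-1}|$ is the $(n-1)$-skeleton of $S(\rho)$, i.e. the union of its cells of dimension at most $n-1$. Canny-Emiris matrix. Let $\boldsymbol{u}_i=\{u_{i,a}\}_{a\in\mathcal{A}_i}$ be variables, $\boldsymbol{u}=(\boldsymbol{u}_0,\dots,\boldsymbol{u}_n)$ and $\mathbb{K}=\mathbb{C}(\boldsymbol{u})$. Each $b\in\mathcal{B}=(\Delta+\delta)\cap M$ lies in $C+\delta$ for a unique $n$-cell $C$ of $S(\rho)$; let $i(b)$ be the largest $i$ with $\dim(C_i)=0$, and $a(b)\in\mathcal{A}_{i(b)}$ the unique point of $C_{i(b)}$. The Canny-Emiris matrix $\mathcal{H}_{\boldsymbol{\mathcal{A}},\boldsymbol{\rho}}\in\mathbb{K}^{\mathcal{B}\times\mathcal{B}}$ has entry at $(b,b')$ equal to $u_{i(b),\,b'-b+a(b)}$ if $b'-b+a(b)\in\mathcal{A}_{i(b)}$, and $0$ otherwise. For $\mathcal{C}\subset\mathcal{B}$, $H_{\boldsymbol{\mathcal{A}},\boldsymbol{\rho},\mathcal{C}}\in\mathbb{Z}[\boldsymbol{u}]$ is the principal minor indexed by $\mathcal{C}$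 (equal to $1$ if $\mathcal{C}=\emptyset$). Restriction. For an $n$-cell $D$ of $S(\phi)$ with components $D_0,\dots,D_n$ set $\boldsymbol{\mathcal{A}}_D=(\mathcal{A}_i\cap D_i)_{i=0}^n$, $\boldsymbol{\rho}_D=(\rho_i|_{D_i})_{i=0}^n$ and $\mathcal{C}_D=\mathcal{C}\cap(D+\delta)$. The data $(\boldsymbol{\mathcal{A}}_D,\boldsymbol{\rho}_D,\delta)$ satisfies the hypotheses of the construction above (with $\Delta$ replaced by $D$); its Canny-Emiris matrix $\mathcal{H}_{\boldsymbol{\mathcal{A}}_D,\boldsymbol{\rho}_D}$ is indexed by $\mathcal{B}_D=\mathcal{B}\cap(D+\delta)$ and involves the variables $u_{i,a}$, $a\in\mathcal{A}_i\cap D_i$. $H_{\boldsymbol{\mathcal{A}}_D,\boldsymbol{\rho}_D,\mathcal{C}_D}$ is its principal minor indexed by $\mathcal{C}_D$. Order and initial part. For $0\ne P\in\mathbb{C}[\boldsymbol{u}]$, $\operatorname{ord}_{\boldsymbol{\omega}}(P)$ is the minimal weight $\sum_{i,a}\omega_{i,a}c_{i,a}$ of the exponents $\boldsymbol{c}$ of the nonzero terms of $P$, and $\operatorname{init}_{\boldsymbol{\omega}}(P)$ is the sum of the terms of $P$ attaining this minimal weight; $\operatorname{ord}_{\boldsymbol{\omega}}(0)=+\infty$ and $\operatorname{init}_{\boldsymbol{\omega}}(0)=0$. *)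

theory Defs
  imports "HOL-Analysis.Analysis" "HOL-Library.Poly_Mapping" "HOL-Library.Set_Algebras"
    "HOL-Library.FuncSet" "HOL-Combinatorics.Permutations"
begin

text \<open>
  A lattice \<open>M\<close> of rank \<open>n\<close> is realised inside some euclidean space, with \<open>M\<^sub>\<real> = span M\<close>; the lattice
  need not have full rank in the ambient space, so that rank \<open>0\<close> is included. Elements of
  \<open>N\<^sub>\<real> = Hom(M, \<real>)\<close> are given by linear functionals on the ambient space, which restrict onto
  the dual of \<open>span M\<close>. A function on a polytope \<open>\<Delta>\<close> is represented by a total function of which
  only the values on \<open>\<Delta>\<close> matter. Families are indexed by \<open>{..n}\<close>.
\<close>

definition lattice_of_rank :: "nat \<Rightarrow> 'a::euclidean_space set \<Rightarrow> bool" where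
  "lattice_of_rank n M \<longleftrightarrow>
     (\<exists>B. finite B \<and> independent B \<and> card B = n \<and>
          M = {\<Sum>b\<in>B. real_of_int (k b) *\<^sub>R b | k. True})"

definition convex_piecewise_affine :: "'a::euclidean_space set \<Rightarrow> ('a \<Rightarrow> real) \<Rightarrow> bool" where
  "convex_piecewise_affine \<Delta> f \<longleftrightarrow>
     convex_on \<Delta> f \<and>
     (\<exists>P. finite P \<and> \<Union>P = \<Delta> \<and>
          (\<forall>Q\<in>P. polytope Q \<and> (\<exists>v c. linear v \<and> (\<forall>x\<in>Q. f x = v x + c))))"

definition defined_on :: "'a::euclidean_space set \<Rightarrow> ('a \<Rightarrow> real) \<Rightarrow> bool" where
  "defined_on A f \<longleftrightarrow>
     (\<exists>\<nu>. \<forall>x \<in> convex hull A.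
        (x, f x) \<in> convex hull ((\<lambda>a. (a, \<nu> a)) ` A) \<and>
        (\<forall>z. (x, z) \<in> convex hull ((\<lambda>a. (a, \<nu> a)) ` A) \<longrightarrow> f x \<le> z))"


subsection \<open>Mixed subdivisions\<close>

definition cell :: "'a::euclidean_space set \<Rightarrow> ('a \<Rightarrow> real) \<Rightarrow> ('a \<Rightarrow> real) \<Rightarrow> 'a set" where
  "cell \<Delta> \<rho> v = {x \<in> \<Delta>. \<forall>y\<in>\<Delta>. \<rho> x + v x \<le> \<rho> y + v y}"

definition subdivision :: "'a::euclidean_space set \<Rightarrow> ('a \<Rightarrow> real) \<Rightarrow> 'a set set" where
  "subdivision \<Delta> \<rho> = {cell \<Delta> \<rho> v | v. linear v}"

definition inf_convolution ::
    "nat \<Rightarrow> (nat \<Rightarrow> 'a::euclidean_space set) \<Rightarrow> (nat \<Rightarrow> 'a \<Rightarrow> real) \<Rightarrow> 'a \<Rightarrow> real" where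
  "inf_convolution n \<Delta> \<rho> x =
     Inf {\<Sum>i\<le>n. \<rho> i (y i) | y. (\<forall>i\<le>n. y i \<in> \<Delta> i) \<and> (\<Sum>i\<le>n. y i) = x}"

text \<open>The sum of the sets \<open>\<Delta> i\<close> below is the Minkowski sum.\<close>

definition mixed_subdivision ::
    "nat \<Rightarrow> (nat \<Rightarrow> 'a::euclidean_space set) \<Rightarrow> (nat \<Rightarrow> 'a \<Rightarrow> real) \<Rightarrow> 'a set set" where
  "mixed_subdivision n \<Delta> \<rho> = subdivision (\<Sum>i\<le>n. \<Delta> i) (inf_convolution n \<Delta> \<rho>)"

definition component ::
    "nat \<Rightarrow> (nat \<Rightarrow> 'a::euclidean_space set) \<Rightarrow> (nat \<Rightarrow> 'a \<Rightarrow> real) \<Rightarrow> 'a set \<Rightarrow> nat \<Rightarrow> 'a set" where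
  "component n \<Delta> \<rho> C i =
     {x i | x. (\<forall>j\<le>n. x j \<in> \<Delta> j) \<and> (\<Sum>j\<le>n. x j) \<in> C \<and>
               inf_convolution n \<Delta> \<rho> (\<Sum>j\<le>n. x j) = (\<Sum>j\<le>n. \<rho> j (x j))}"

definition n_cells ::
    "nat \<Rightarrow> (nat \<Rightarrow> 'a::euclidean_space set) \<Rightarrow> (nat \<Rightarrow> 'a \<Rightarrow> real) \<Rightarrow> 'a set set" where
  "n_cells n \<Delta> \<rho> = {C \<in> mixed_subdivision n \<Delta> \<rho>. aff_dim C = int n}"

definition skeleton ::
    "nat \<Rightarrow> (nat \<Rightarrow> 'a::euclidean_space set) \<Rightarrow> (nat \<Rightarrow> 'a \<Rightarrow> real) \<Rightarrow> 'a set" where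
  "skeleton n \<Delta> \<rho> = \<Union>{C \<in> mixed_subdivision n \<Delta> \<rho>. aff_dim C \<le> int n - 1}"

definition tight ::
    "nat \<Rightarrow> (nat \<Rightarrow> 'a::euclidean_space set) \<Rightarrow> (nat \<Rightarrow> 'a \<Rightarrow> real) \<Rightarrow> bool" where
  "tight n \<Delta> \<rho> \<longleftrightarrow>
     (\<forall>C \<in> n_cells n \<Delta> \<rho>. (\<Sum>i\<le>n. aff_dim (component n \<Delta> \<rho> C i)) = int n)"

text \<open>\<open>coarser n \<Delta> \<phi> \<rho>\<close> is the relation \<open>S(\<phi>) \<preceq> S(\<rho>)\<close>.\<close>

definition coarser ::
    "nat \<Rightarrow> (nat \<Rightarrow> 'a::euclidean_space set) \<Rightarrow> (nat \<Rightarrow> 'a \<Rightarrow> real) \<Rightarrow> (nat \<Rightarrow> 'a \<Rightarrow> real) \<Rightarrow> bool" where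
  "coarser n \<Delta> \<phi> \<rho> \<longleftrightarrow>
     (\<forall>C \<in> mixed_subdivision n \<Delta> \<rho>. \<exists>D \<in> mixed_subdivision n \<Delta> \<phi>.
        C \<subseteq> D \<and> (\<forall>i\<le>n. component n \<Delta> \<rho> C i \<subseteq> component n \<Delta> \<phi> D i))"

definition generic ::
    "nat \<Rightarrow> 'a::euclidean_space set \<Rightarrow> (nat \<Rightarrow> 'a set) \<Rightarrow> (nat \<Rightarrow> 'a \<Rightarrow> real) \<Rightarrow> 'a \<Rightarrow> bool" where
  "generic n M \<Delta> \<rho> \<delta> \<longleftrightarrow> (+) \<delta> ` skeleton n \<Delta> \<rho> \<inter> M = {}"


subsection \<open>The Canny-Emiris matrix\<close>

text \<open>
  The variable \<open>u\<^bsub>i,a\<^esub>\<close> is indexed by the pair \<open>(i, a)\<close>. The matrix is taken over the polynomial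
  ring \<open>\<complex>[u]\<close>, to which all its entries belong, rather than over its field of fractions.
\<close>

type_synonym 'a u_poly = "(nat \<times> 'a \<Rightarrow>\<^sub>0 nat) \<Rightarrow>\<^sub>0 complex"

definition u_var :: "nat \<Rightarrow> 'a \<Rightarrow> 'a u_poly" where
  "u_var i a = Poly_Mapping.single (Poly_Mapping.single (i, a) 1) 1"

definition hulls :: "(nat \<Rightarrow> 'a::euclidean_space set) \<Rightarrow> nat \<Rightarrow> 'a set" where
  "hulls A i = convex hull (A i)"

definition index_set :: "nat \<Rightarrow> 'a::euclidean_space set \<Rightarrow> (nat \<Rightarrow> 'a set) \<Rightarrow> 'a \<Rightarrow> 'a set" where
  "index_set n M A \<delta> = (+) \<delta> ` (\<Sum>i\<le>n. hulls A i) \<inter> M"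

definition cell_of ::
    "nat \<Rightarrow> (nat \<Rightarrow> 'a::euclidean_space set) \<Rightarrow> (nat \<Rightarrow> 'a \<Rightarrow> real) \<Rightarrow> 'a \<Rightarrow> 'a \<Rightarrow> 'a set" where
  "cell_of n A \<rho> \<delta> b = (THE C. C \<in> n_cells n (hulls A) \<rho> \<and> b \<in> (+) \<delta> ` C)"

definition row_index ::
    "nat \<Rightarrow> (nat \<Rightarrow> 'a::euclidean_space set) \<Rightarrow> (nat \<Rightarrow> 'a \<Rightarrow> real) \<Rightarrow> 'a \<Rightarrow> 'a \<Rightarrow> nat" where
  "row_index n A \<rho> \<delta> b =
     Max {i. i \<le> n \<and> aff_dim (component n (hulls A) \<rho> (cell_of n A \<rho> \<delta> b) i) = 0}"

definition row_point ::
    "nat \<Rightarrow> (nat \<Rightarrow> 'a::euclidean_space set) \<Rightarrow> (nat \<Rightarrow> 'a \<Rightarrow> real) \<Rightarrow> 'a \<Rightarrow> 'a \<Rightarrow> 'a" where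
  "row_point n A \<rho> \<delta> b =
     the_elem (component n (hulls A) \<rho> (cell_of n A \<rho> \<delta> b) (row_index n A \<rho> \<delta> b))"

definition canny_emiris ::
    "nat \<Rightarrow> (nat \<Rightarrow> 'a::euclidean_space set) \<Rightarrow> (nat \<Rightarrow> 'a \<Rightarrow> real) \<Rightarrow> 'a \<Rightarrow> 'a \<Rightarrow> 'a \<Rightarrow> 'a u_poly" where
  "canny_emiris n A \<rho> \<delta> b b' =
     (let i = row_index n A \<rho> \<delta> b; a' = b' - b + row_point n A \<rho> \<delta> b
      in if a' \<in> A i then u_var i a' else 0)"

text \<open>Leibniz determinant of the square submatrix of \<open>H\<close> with rows and columns indexed by a finite
  set \<open>S\<close>, as in the library's \<open>det\<close>, which requires the index set to be a type.\<close>

definition principal_minor :: "('a \<Rightarrow> 'a \<Rightarrow> 'r::comm_ring_1) \<Rightarrow> 'a set \<Rightarrow> 'r" where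
  "principal_minor H S = (\<Sum>p | p permutes S. of_int (sign p) * (\<Prod>b\<in>S. H b (p b)))"

definition ce_minor ::
    "nat \<Rightarrow> (nat \<Rightarrow> 'a::euclidean_space set) \<Rightarrow> (nat \<Rightarrow> 'a \<Rightarrow> real) \<Rightarrow> 'a \<Rightarrow> 'a set \<Rightarrow> 'a u_poly" where
  "ce_minor n A \<rho> \<delta> S = principal_minor (canny_emiris n A \<rho> \<delta>) S"

definition restrict_supports ::
    "nat \<Rightarrow> (nat \<Rightarrow> 'a::euclidean_space set) \<Rightarrow> (nat \<Rightarrow> 'a \<Rightarrow> real) \<Rightarrow> 'a set \<Rightarrow> nat \<Rightarrow> 'a set" where
  "restrict_supports n A \<phi> D i = A i \<inter> component n (hulls A) \<phi> D i"

text \<open>The components of \<open>D\<close> are taken with respect to \<open>\<phi>\<close>. The construction applied to the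
  restricted data uses the polytopes \<open>convex hull (A i \<inter> D\<^sub>i)\<close>, which coincide with the components
  \<open>D\<^sub>i\<close> of an \<open>n\<close>-cell \<open>D\<close> of \<open>S(\<phi>)\<close> when \<open>S(\<phi>) \<preceq> S(\<rho>)\<close> and the \<open>\<rho> i\<close> are defined on the \<open>A i\<close>.\<close>

definition restrict_functions ::
    "nat \<Rightarrow> (nat \<Rightarrow> 'a::euclidean_space set) \<Rightarrow> (nat \<Rightarrow> 'a \<Rightarrow> real) \<Rightarrow> (nat \<Rightarrow> 'a \<Rightarrow> real) \<Rightarrow>
     'a set \<Rightarrow> nat \<Rightarrow> 'a \<Rightarrow> real" where
  "restrict_functions n A \<phi> \<rho> D i = restrict (\<rho> i) (component n (hulls A) \<phi> D i)"


subsection \<open>Orders and initial parts\<close>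

definition weight :: "(nat \<times> 'a \<Rightarrow> real) \<Rightarrow> (nat \<times> 'a \<Rightarrow>\<^sub>0 nat) \<Rightarrow> real" where
  "weight \<omega> c = (\<Sum>k\<in>Poly_Mapping.keys c. \<omega> k * real (Poly_Mapping.lookup c k))"

definition ord_weight :: "(nat \<times> 'a \<Rightarrow> real) \<Rightarrow> 'a u_poly \<Rightarrow> ereal" where
  "ord_weight \<omega> P = (if P = 0 then \<infinity> else ereal (Min (weight \<omega> ` Poly_Mapping.keys P)))"

definition init_weight :: "(nat \<times> 'a \<Rightarrow> real) \<Rightarrow> 'a u_poly \<Rightarrow> 'a u_poly" where
  "init_weight \<omega> P =
     (\<Sum>c | c \<in> Poly_Mapping.keys P \<and> ereal (weight \<omega> c) = ord_weight \<omega> P.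
        Poly_Mapping.single c (Poly_Mapping.lookup P c))"

end

theory Submission
  imports Defs
begin

text \<open>
  Write \<open>\<phi>\<close> also for the inf-convolution of the \<open>\<phi> i\<close>. The entry of the Canny-Emiris matrix at
  \<open>(b, b')\<close> is the variable \<open>u\<^bsub>i,a'\<^esub>\<close> with \<open>i = i(b)\<close> and \<open>b' - \<delta> = (b - \<delta>) - a(b) + a'\<close>. A decomposition
  of \<open>b - \<delta>\<close> along the components of its cell in \<open>S(\<rho>)\<close> is optimal for \<open>\<phi>\<close> as well, because
  \<open>S(\<phi>) \<preceq> S(\<rho>)\<close>, and its \<open>i\<close>-th summand is \<open>a(b)\<close>. Exchanging this summand for \<open>a'\<close> yields

  \<open>\<phi>(b' - \<delta>) - \<phi>(b - \<delta>) \<le> \<phi>\<^sub>i(a') - \<phi>\<^sub>i(a(b))\<close>.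

  If \<open>D\<close> denotes the cell of \<open>S(\<phi>)\<close> containing \<open>b - \<delta>\<close>, then equality holds exactly if \<open>a'\<close> lies in
  the component \<open>D\<^sub>i\<close>, and in this case \<open>b' - \<delta>\<close> lies in \<open>D\<close>, too. Both are in the lemma
  \<open>entry_weight\<close>, which uses that \<open>b - \<delta>\<close> is in the relative interior of its cell in \<open>S(\<rho>)\<close>: at
  such a point the functional defining a cell of \<open>S(\<phi>)\<close> is determined on \<open>span M\<close>. This is where
  the genericity of \<open>\<delta>\<close> enters.

  Summed over a permutation of \<open>\<C>\<close>, the left-hand sides cancel. Hence every term of the minor has at
  least the weight of the diagonal term, and the terms of the same weight are those of the matrix
  obtained by deleting the entries for which the inequality is strict. That matrix is block
  diagonal along the \<open>n\<close>-cells \<open>D\<close> of \<open>S(\<phi>)\<close>, and the block of \<open>D\<close> is the Canny-Emiris matrix of the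
  restricted data: the components of \<open>D\<close> are spanned by the points of the \<open>A i\<close> in them
  (\<open>component_eq_hull_of_supports\<close>), and the cells of \<open>S(\<rho>)\<close> inside \<open>D\<close> are cells of the restricted
  subdivision with the same components (\<open>restricted_rows\<close>).

  It remains to see that the diagonal term is not cancelled. The same argument applied to \<open>\<rho>\<close> in
  place of \<open>\<phi>\<close> gives blocks in which \<open>a(b)\<close> is the only point of the component \<open>i(b)\<close>, so that
  \<open>a' = a(b)\<close> and \<open>b' = b\<close>. Thus the identity is the only permutation whose term has the \<open>\<rho>\<close>-weight of the
  diagonal term (\<open>permutation_eq_id_if_diagonal_weight\<close>), and no other term has the same monomial.
\<close>

section \<open>Linear functionals on convex sets\<close>

text \<open>Prolong the segment from \<open>y\<close> to \<open>x\<close> inside \<open>C\<close> a little beyond \<open>x\<close>: if \<open>w y\<close> were larger than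
  \<open>w x\<close>, then \<open>w\<close> would be smaller than \<open>w x\<close> at the new end point.\<close>

lemma linear_const_on_convex_if_rel_interior_min:
  fixes w :: "'a::euclidean_space \<Rightarrow> real"
  assumes w: "linear w" and C: "convex C" and x: "x \<in> rel_interior C"
    and le: "\<And>y. y \<in> C \<Longrightarrow> w x \<le> w y" and y: "y \<in> C"
  shows "w y = w x"
proof -
  obtain e where e: "e > 1" "(1 - e) *\<^sub>R y + e *\<^sub>R x \<in> C"
    using x y convex_rel_interior_iff[OF C] by blast
  have "w x \<le> (1 - e) * w y + e * w x"
    using le[OF e(2)] w by (simp add: linear_add linear_scale)
  then have "(e - 1) * w y \<le> (e - 1) * w x"
    by (simp add: algebra_simps)
  then have "w y \<le> w x"
    using e(1) by simp
  with le[OF y] show ?thesis by simp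
qed

lemma linear_zero_on_span_if_const_on_full_dim:
  fixes u :: "'a::euclidean_space \<Rightarrow> real"
  assumes u: "linear u" and C: "C \<subseteq> span M" "aff_dim C = int (dim M)"
    and const: "\<And>x y. x \<in> C \<Longrightarrow> y \<in> C \<Longrightarrow> u x = u y" and z: "z \<in> span M"
  shows "u z = 0"
proof -
  have "C \<noteq> {}" using C(2) by (auto simp: aff_dim_empty)
  then obtain x0 where x0: "x0 \<in> C" by blast
  have "aff_dim C = aff_dim (span M)"
    using C(2) by (simp add: aff_dim_subspace)
  then have hull: "affine hull C = span M"
    using aff_dim_eq_full_gen[OF C(1)] by (simp add: subspace_imp_affine hull_same)
  have "affine {y. u y = u x0}"
    using u by (auto simp: affine_def linear_add linear_scale simp flip: distrib_right)
  moreover have "C \<subseteq> {y. u y = u x0}"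
    using const x0 by blast
  ultimately have sub: "span M \<subseteq> {y. u y = u x0}"
    using hull by (metis hull_minimal)
  then have "u 0 = u x0" using span_zero by blast
  with sub z u show ?thesis by (auto simp: linear_0)
qed

section \<open>Cells of a single function\<close>

lemma cell_subset: "cell \<Delta> f v \<subseteq> \<Delta>"
  by (auto simp: cell_def)

text \<open>On the cell of \<open>u\<close> the functions \<open>f\<close> and \<open>-u\<close> differ by a constant, so that \<open>v - u\<close> attains
  its minimum over \<open>C\<close> at every point of \<open>C\<close> in the cell of \<open>v\<close>. At a relative interior point this
  forces \<open>v - u\<close> to be constant.\<close>

lemma functionals_agree_at_rel_interior_point:
  fixes f :: "'a::euclidean_space \<Rightarrow> real"
  assumes C: "convex C" "C \<subseteq> cell \<Delta> f u" and x: "x \<in> rel_interior C" "x \<in> cell \<Delta> f v"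
    and lin: "linear u" "linear v" and y: "y \<in> C"
  shows "v y - u y = v x - u x"
proof (rule linear_const_on_convex_if_rel_interior_min[of "\<lambda>y. v y - u y", OF _ C(1) x(1) _ y])
  show "linear (\<lambda>y. v y - u y)"
    using lin by (intro linear_compose_sub)
next
  fix z assume z: "z \<in> C"
  have xC: "x \<in> C" using x(1) rel_interior_subset by blast
  have "f x + u x = f z + u z"
    using C(2) xC z by (auto simp: cell_def subset_iff intro!: order_antisym)
  moreover have "f x + v x \<le> f z + v z"
    using x(2) C(2) z by (auto simp: cell_def subset_iff)
  ultimately show "v x - u x \<le> v z - u z" by linarith
qed

text \<open>Two linear functionals that differ by a constant on a set with affine hull \<open>span M\<close> agree on
  \<open>span M\<close>, because \<open>0\<close> belongs to it, and so they define the same cell.\<close>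

lemma cell_unique_at_rel_interior_point:
  fixes f :: "'a::euclidean_space \<Rightarrow> real"
  assumes C: "convex C" "C \<subseteq> cell \<Delta> f u" "aff_dim C = int (dim M)"
    and x: "x \<in> rel_interior C" "x \<in> cell \<Delta> f v"
    and lin: "linear u" "linear v" and \<Delta>: "\<Delta> \<subseteq> span M"
  shows "cell \<Delta> f v = cell \<Delta> f u"
proof -
  have "v z = u z" if z: "z \<in> span M" for z
  proof -
    have "v z - u z = 0"
    proof (rule linear_zero_on_span_if_const_on_full_dim[where u = "\<lambda>z. v z - u z", OF _ _ C(3) _ z])
      show "linear (\<lambda>z. v z - u z)" using lin by (intro linear_compose_sub)
      show "C \<subseteq> span M" using C(2) cell_subset \<Delta> by blast
      show "v y - u y = v y' - u y'" if "y \<in> C" "y' \<in> C" for y y'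
        using functionals_agree_at_rel_interior_point[OF C(1,2) x lin] that by metis
    qed
    then show ?thesis by simp
  qed
  then have "v z = u z" if "z \<in> \<Delta>" for z using that \<Delta> by blast
  then show ?thesis by (auto simp: cell_def)
qed

lemma convex_cell:
  assumes "convex_on \<Delta> f" "linear v"
  shows "convex (cell \<Delta> f v)"
proof (rule convexI)
  fix x y and s t :: real
  assume xy: "x \<in> cell \<Delta> f v" "y \<in> cell \<Delta> f v" and st: "0 \<le> s" "0 \<le> t" "s + t = 1"
  have xyD: "x \<in> \<Delta>" "y \<in> \<Delta>" using xy by (auto simp: cell_def)
  have D: "s *\<^sub>R x + t *\<^sub>R y \<in> \<Delta>"
    using convex_on_imp_convex[OF assms(1)] xyD st by (simp add: convexD)
  have t: "s = 1 - t" using st by simp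
  have f: "f (s *\<^sub>R x + t *\<^sub>R y) \<le> s * f x + t * f y"
    unfolding t using convex_onD[OF assms(1), of t x y] xyD st by simp
  have "f (s *\<^sub>R x + t *\<^sub>R y) + v (s *\<^sub>R x + t *\<^sub>R y) \<le> f z + v z" if z: "z \<in> \<Delta>" for z
  proof -
    have "f (s *\<^sub>R x + t *\<^sub>R y) + v (s *\<^sub>R x + t *\<^sub>R y) \<le> s * (f x + v x) + t * (f y + v y)"
      using f assms(2) by (simp add: linear_add linear_scale algebra_simps)
    also have "\<dots> \<le> s * (f z + v z) + t * (f z + v z)"
    proof -
      have "f x + v x \<le> f z + v z" "f y + v y \<le> f z + v z"
        using xy z by (auto simp: cell_def)
      from mult_left_mono[OF this(1) st(1)] mult_left_mono[OF this(2) st(2)] show ?thesis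
        by linarith
    qed
    also have "\<dots> = f z + v z"
      using st by (simp flip: distrib_right)
    finally show ?thesis .
  qed
  with D show "s *\<^sub>R x + t *\<^sub>R y \<in> cell \<Delta> f v" by (simp add: cell_def)
qed

lemma linear_imp_continuous_on:
  fixes v :: "'a::euclidean_space \<Rightarrow> real"
  shows "linear v \<Longrightarrow> continuous_on S v"
  by (simp add: linear_conv_bounded_linear linear_continuous_on)

lemma cell_nonempty:
  fixes f :: "'a::euclidean_space \<Rightarrow> real"
  assumes "compact \<Delta>" "\<Delta> \<noteq> {}" "continuous_on \<Delta> f" "linear v"
  shows "cell \<Delta> f v \<noteq> {}"
proof -
  have "continuous_on \<Delta> (\<lambda>x. f x + v x)"
    using assms continuous_on_add linear_imp_continuous_on by blast
  then obtain x where "x \<in> \<Delta>" "\<forall>y\<in>\<Delta>. f x + v x \<le> f y + v y"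
    using continuous_attains_inf assms by blast
  then show ?thesis by (auto simp: cell_def)
qed

lemma compact_cell:
  fixes f :: "'a::euclidean_space \<Rightarrow> real"
  assumes "compact \<Delta>" "continuous_on \<Delta> f" "linear v"
  shows "compact (cell \<Delta> f v)"
proof -
  have cont: "continuous_on \<Delta> (\<lambda>x. f x + v x)"
    using assms continuous_on_add linear_imp_continuous_on by blast
  show ?thesis
  proof (cases "cell \<Delta> f v = {}")
    case False
    then obtain x0 where x0: "x0 \<in> cell \<Delta> f v" by blast
    have "cell \<Delta> f v = {x \<in> \<Delta>. f x + v x \<le> f x0 + v x0}"
      using x0 by (auto simp: cell_def intro: order_trans)
    also have "\<dots> = \<Delta> \<inter> (\<lambda>x. f x + v x) -` {..f x0 + v x0}" by auto
    also have "closed \<dots>"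
      using assms(1) cont
      by (intro continuous_closed_preimage) (auto intro: compact_imp_closed)
    finally have "closed (cell \<Delta> f v)" .
    then show ?thesis
      using assms(1) cell_subset by (metis compact_Int_closed inf.absorb_iff2)
  qed simp
qed

text \<open>A convex function has a subgradient at each relative interior point of its domain: take a
  hyperplane that supports the epigraph there. It is not vertical, as its trace on the domain
  would support the domain at a relative interior point.\<close>

lemma rel_interior_point_in_some_cell:
  fixes f :: "'a::euclidean_space \<Rightarrow> real"
  assumes f: "convex_on \<Delta> f" and x: "x \<in> rel_interior \<Delta>"
  shows "\<exists>v. linear v \<and> x \<in> cell \<Delta> f v"
proof -
  define E where "E = {(y, z). y \<in> \<Delta> \<and> f y \<le> z}"
  have \<Delta>: "convex \<Delta>" using f convex_on_imp_convex by blast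
  have xD: "x \<in> \<Delta>" using x rel_interior_subset by blast
  have E: "convex E"
  proof -
    have "E = epigraph \<Delta> f" by (auto simp: E_def epigraph_def)
    then show ?thesis using f convex_epigraph by auto
  qed
  have xE: "(x, f x) \<in> E" using xD by (simp add: E_def)
  have "(x, f x) \<notin> rel_interior E"
  proof
    assume "(x, f x) \<in> rel_interior E"
    moreover have "(x, f x + 1) \<in> E" using xD by (simp add: E_def)
    ultimately obtain e :: real where e: "e > 1"
      "(1 - e) *\<^sub>R (x, f x + 1) + e *\<^sub>R (x, f x) \<in> E"
      using convex_rel_interior_iff[OF E] xE by blast
    then have "f ((1 - e) *\<^sub>R x + e *\<^sub>R x) \<le> (1 - e) * (f x + 1) + e * f x"
      by (simp add: E_def)
    moreover have "(1 - e) *\<^sub>R x + e *\<^sub>R x = x"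
      by (simp flip: scaleR_left_distrib)
    ultimately show False using e(1) by (simp add: algebra_simps)
  qed
  then obtain a where a: "\<And>p. p \<in> E \<Longrightarrow> a \<bullet> (x, f x) \<le> a \<bullet> p"
    "\<And>p. p \<in> rel_interior E \<Longrightarrow> a \<bullet> (x, f x) < a \<bullet> p"
    using supporting_hyperplane_relative_frontier[OF E] xE closure_subset by (metis subsetD)
  obtain w s where ws: "a = (w, s)" by (cases a)
  have le: "w \<bullet> x + s * f x \<le> w \<bullet> y + s * z" if "y \<in> \<Delta>" "f y \<le> z" for y z
    using a(1)[of "(y, z)"] that by (simp add: E_def ws inner_real_def)
  have "s \<ge> 0" using le[OF xD, of "f x + 1"] by (simp add: algebra_simps)
  moreover have "s \<noteq> 0"
  proof
    assume s: "s = 0"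
    have const: "w \<bullet> y = w \<bullet> x" if "y \<in> \<Delta>" for y
      using linear_const_on_convex_if_rel_interior_min[of "(\<bullet>) w", OF _ \<Delta> x _ that] le s
      by (auto intro: bounded_linear.linear bounded_linear_inner_right)
    have "rel_interior E \<noteq> {}" using rel_interior_eq_empty[OF E] xE by blast
    then obtain p where p: "p \<in> rel_interior E" by blast
    then have "p \<in> E" using rel_interior_subset by blast
    then show False
      using a(2)[OF p] const s by (cases p) (simp add: E_def ws)
  qed
  ultimately have s: "s > 0" by simp
  define v where "v = (\<lambda>y. (w \<bullet> y) / s)"
  have "linear v"
    unfolding v_def by (intro linearI) (auto simp: inner_add_right add_divide_distrib)
  moreover have "f x + v x \<le> f y + v y" if "y \<in> \<Delta>" for y
  proof -
    have "w \<bullet> x + s * f x \<le> w \<bullet> y + s * f y" using le[OF that] by simp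
    then have "(w \<bullet> x + s * f x) / s \<le> (w \<bullet> y + s * f y) / s"
      using s by (intro divide_right_mono) auto
    then show ?thesis using s by (simp add: v_def add_divide_distrib)
  qed
  ultimately show ?thesis using xD by (auto simp: cell_def)
qed

section \<open>Polyhedral functions\<close>

text \<open>Polyhedrality is expressed by the cells rather than by the epigraph of \<open>f\<close>, because this form
  passes to inf-convolutions by taking Minkowski sums of the spanning sets.\<close>

locale polyhedral_function =
  fixes \<Delta> V :: "'a::euclidean_space set" and f :: "'a \<Rightarrow> real"
  assumes convex_f: "convex_on \<Delta> f"
    and finite_V: "finite V" and V_subset: "V \<subseteq> \<Delta>"
    and cell_ne: "linear v \<Longrightarrow> cell \<Delta> f v \<noteq> {}"
    and cell_spanned: "linear v \<Longrightarrow> cell \<Delta> f v \<subseteq> convex hull (V \<inter> cell \<Delta> f v)"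
begin

lemma cell_eq_hull: "linear v \<Longrightarrow> cell \<Delta> f v = convex hull (V \<inter> cell \<Delta> f v)"
  by (intro equalityI cell_spanned hull_minimal convex_cell convex_f) auto

lemma subdivision_subset: "subdivision \<Delta> f \<subseteq> (\<lambda>W. convex hull W) ` Pow V"
proof
  fix C assume "C \<in> subdivision \<Delta> f"
  then obtain v where "linear v" "C = cell \<Delta> f v" by (auto simp: subdivision_def)
  then have "C = convex hull (V \<inter> C)" using cell_eq_hull by blast
  then show "C \<in> (\<lambda>W. convex hull W) ` Pow V" by blast
qed

lemma finite_subdivision: "finite (subdivision \<Delta> f)"
  using subdivision_subset finite_V by (meson finite_Pow_iff finite_imageI finite_subset)

lemma closed_subdivision_cell: "C \<in> subdivision \<Delta> f \<Longrightarrow> closed C"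
proof -
  assume "C \<in> subdivision \<Delta> f"
  then obtain W where "C = convex hull W" "W \<subseteq> V" using subdivision_subset by blast
  then show "closed C"
    using finite_V finite_subset by (metis compact_imp_closed finite_imp_compact_convex_hull)
qed

text \<open>The cells cover the relative interior, and their union is closed because there are only
  finitely many.\<close>

lemma subdivision_covers: "\<Delta> \<subseteq> \<Union>(subdivision \<Delta> f)"
proof -
  have "rel_interior \<Delta> \<subseteq> \<Union>(subdivision \<Delta> f)"
    using rel_interior_point_in_some_cell[OF convex_f] by (force simp: subdivision_def)
  then have "closure (rel_interior \<Delta>) \<subseteq> \<Union>(subdivision \<Delta> f)"
    using finite_subdivision closed_subdivision_cell by (intro closure_minimal closed_Union) auto
  moreover have "closure (rel_interior \<Delta>) = closure \<Delta>"
    using convex_f convex_on_imp_convex convex_closure_rel_interior by blast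
  ultimately show ?thesis using closure_subset by blast
qed

text \<open>A relative boundary point of the cell of \<open>u\<close> lies in a proper face of it, cut out by some
  functional \<open>w\<close>. The cell of a small perturbation \<open>u + \<epsilon>w\<close> is contained in that face; it suffices
  that \<open>\<epsilon>\<close> is so small that points of \<open>V\<close> outside the cell of \<open>u\<close> do not become minimal.\<close>

lemma boundary_point_in_smaller_cell:
  assumes u: "linear u" and x: "x \<in> cell \<Delta> f u" "x \<notin> rel_interior (cell \<Delta> f u)"
  obtains w :: "'a \<Rightarrow> real" and v z where "linear w" "linear v" "x \<in> cell \<Delta> f v"
    "\<And>y. y \<in> cell \<Delta> f v \<Longrightarrow> w y = w x" "z \<in> cell \<Delta> f u" "w z \<noteq> w x"
proof -
  define C where "C = cell \<Delta> f u"
  have C: "convex C" unfolding C_def using convex_cell convex_f u by blast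
  have xC: "x \<in> C" "x \<in> closure C" using x closure_subset C_def by auto
  obtain a where a: "\<And>y. y \<in> closure C \<Longrightarrow> a \<bullet> x \<le> a \<bullet> y"
    "\<And>y. y \<in> rel_interior C \<Longrightarrow> a \<bullet> x < a \<bullet> y"
    using supporting_hyperplane_relative_frontier[OF C xC(2)] x(2) C_def by metis
  define w where "w = (\<bullet>) a"
  have w: "linear w"
    unfolding w_def by (intro bounded_linear.linear bounded_linear_inner_right)
  have w_le: "w x \<le> w y" if "y \<in> C" for y
    unfolding w_def using a(1) that closure_subset by blast
  have "rel_interior C \<noteq> {}" using rel_interior_eq_empty[OF C] xC by blast
  then obtain z where z: "z \<in> C" "w z \<noteq> w x"
    using a(2) rel_interior_subset w_def by (metis all_not_in_conv less_irrefl subsetD)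
  have gap: "\<exists>e>0. \<forall>e'. 0 < e' \<and> e' < e \<longrightarrow> f x + u x + e' * w x < f p + u p + e' * w p"
    if p: "p \<in> V - C" for p
  proof -
    have pD: "p \<in> \<Delta>" using p V_subset by blast
    have "f x + u x < f p + u p"
    proof (rule ccontr)
      assume "\<not> ?thesis"
      with pD x(1) have "p \<in> C" by (fastforce simp: C_def cell_def)
      with p show False by blast
    qed
    then have pos: "0 < f p + u p - (f x + u x)" by simp
    define e where "e = (f p + u p - (f x + u x)) / (\<bar>w x - w p\<bar> + 1)"
    have "e > 0" using pos by (simp add: e_def)
    moreover have "f x + u x + e' * w x < f p + u p + e' * w p" if e': "0 < e'" "e' < e" for e'
    proof -
      have "e' * (w x - w p) \<le> e' * (\<bar>w x - w p\<bar> + 1)" using e' by (intro mult_left_mono) auto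
      also have "\<dots> < e * (\<bar>w x - w p\<bar> + 1)" using e' by (intro mult_strict_right_mono) auto
      also have "\<dots> = f p + u p - (f x + u x)"
        unfolding e_def by (simp add: add_nonneg_eq_0_iff)
      finally show ?thesis by (simp add: algebra_simps)
    qed
    ultimately show ?thesis by blast
  qed
  then obtain e where e: "\<And>p. p \<in> V - C \<Longrightarrow> e p > 0"
    "\<And>p e'. p \<in> V - C \<Longrightarrow> 0 < e' \<Longrightarrow> e' < e p \<Longrightarrow> f x + u x + e' * w x < f p + u p + e' * w p"
    by metis
  define \<epsilon> where "\<epsilon> = Min (insert 1 (e ` (V - C))) / 2"
  have fin: "finite (insert 1 (e ` (V - C)))" using finite_V by simp
  have "Min (insert 1 (e ` (V - C))) > 0"
    using fin e(1) by (subst Min_gr_iff) auto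
  then have \<epsilon>: "\<epsilon> > 0" "\<epsilon> < Min (insert 1 (e ` (V - C)))" by (auto simp: \<epsilon>_def)
  have outside: "f x + u x + \<epsilon> * w x < f p + u p + \<epsilon> * w p" if "p \<in> V - C" for p
    using e(2)[OF that \<epsilon>(1)] \<epsilon>(2) fin that by simp
  have inside: "f p + u p = f x + u x" if "p \<in> C" for p
    using that x(1) by (auto simp: C_def cell_def intro: order_antisym)
  define v where "v = (\<lambda>y. u y + \<epsilon> * w y)"
  have v: "linear v"
    unfolding v_def using u w by (intro linearI) (auto simp: linear_add linear_scale algebra_simps)
  have V_ge: "f x + v x \<le> f p + v p" if "p \<in> V" for p
  proof (cases "p \<in> C")
    case True
    then have "\<epsilon> * w x \<le> \<epsilon> * w p" using w_le \<epsilon>(1) by simp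
    with inside[OF True] show ?thesis by (simp add: v_def)
  next
    case False
    with outside[of p] that show ?thesis by (simp add: v_def)
  qed
  obtain p0 where p0: "p0 \<in> V" "p0 \<in> cell \<Delta> f v"
  proof -
    have "V \<inter> cell \<Delta> f v \<noteq> {}" using cell_ne[OF v] cell_spanned[OF v] by auto
    then show ?thesis using that by blast
  qed
  have xD: "x \<in> \<Delta>" using x(1) cell_subset by blast
  have xv: "x \<in> cell \<Delta> f v"
    using V_ge[OF p0(1)] p0(2) xD by (force simp: cell_def)
  have "V \<inter> cell \<Delta> f v \<subseteq> {y. w y = w x}"
  proof safe
    fix p assume p: "p \<in> V" "p \<in> cell \<Delta> f v"
    then have eq: "f p + v p = f x + v x"
      using xv by (auto simp: cell_def intro: order_antisym)
    then have "p \<in> C" using outside[of p] p(1) by (auto simp: v_def)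
    then have "\<epsilon> * w p = \<epsilon> * w x" using inside[of p] eq unfolding v_def by linarith
    then show "w p = w x" using \<epsilon>(1) by simp
  qed
  moreover have "convex {y. w y = w x}"
    using w by (auto simp: convex_def linear_add linear_scale simp flip: distrib_right)
  ultimately have "cell \<Delta> f v \<subseteq> {y. w y = w x}"
    using cell_spanned[OF v] hull_minimal by (metis order_trans)
  with that[OF w v xv] z show ?thesis by (auto simp: C_def)
qed

end

section \<open>Inf-convolutions\<close>

lemma mem_Minkowski_sum_iff:
  "x \<in> (\<Sum>i\<le>n. \<Delta> i) \<longleftrightarrow> (\<exists>y. (\<forall>i\<le>n. y i \<in> \<Delta> i) \<and> (\<Sum>i\<le>n. y i) = x)"
  for \<Delta> :: "nat \<Rightarrow> 'a::comm_monoid_add set"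
  by (subst set_sum_alt) auto

lemma Minkowski_sum_mono:
  fixes S T :: "nat \<Rightarrow> 'a::comm_monoid_add set"
  assumes "\<And>i. i \<le> n \<Longrightarrow> S i \<subseteq> T i"
  shows "(\<Sum>i\<le>n. S i) \<subseteq> (\<Sum>i\<le>n. T i)"
  unfolding subset_iff mem_Minkowski_sum_iff using assms by blast

locale convex_family =
  fixes n :: nat and \<Delta> :: "nat \<Rightarrow> 'a::euclidean_space set" and f :: "nat \<Rightarrow> 'a \<Rightarrow> real"
  assumes compact_dom: "i \<le> n \<Longrightarrow> compact (\<Delta> i)"
    and dom_nonempty: "i \<le> n \<Longrightarrow> \<Delta> i \<noteq> {}"
    and continuous_f: "i \<le> n \<Longrightarrow> continuous_on (\<Delta> i) (f i)"
    and convex_f: "i \<le> n \<Longrightarrow> convex_on (\<Delta> i) (f i)"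
begin

abbreviation total_dom where "total_dom \<equiv> \<Sum>i\<le>n. \<Delta> i"
abbreviation conv_f where "conv_f \<equiv> inf_convolution n \<Delta> f"

text \<open>By compactness the infimum is attained; tuples are truncated beyond \<open>n\<close> to make their set
  compact in the product topology.\<close>

lemma inf_convolution_attained:
  assumes "x \<in> total_dom"
  obtains y where "\<And>i. i \<le> n \<Longrightarrow> y i \<in> \<Delta> i" "(\<Sum>i\<le>n. y i) = x"
    "conv_f x = (\<Sum>i\<le>n. f i (y i))"
    "\<And>y'. (\<And>i. i \<le> n \<Longrightarrow> y' i \<in> \<Delta> i) \<Longrightarrow> (\<Sum>i\<le>n. y' i) = x \<Longrightarrow> conv_f x \<le> (\<Sum>i\<le>n. f i (y' i))"
proof -
  define S where "S = (PiE UNIV (\<lambda>i. if i \<le> n then \<Delta> i else {0}) :: (nat \<Rightarrow> 'a) set)"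
  have "compactin (product_topology (\<lambda>_::nat. euclidean :: 'a topology) UNIV) S"
    unfolding S_def compactin_PiE using compact_dom by auto
  then have S: "compact S"
    by (simp add: euclidean_product_topology)
  define T where "T = S \<inter> (\<lambda>y. \<Sum>i\<le>n. y i) -` {x}"
  have "closed ((\<lambda>y::nat \<Rightarrow> 'a. \<Sum>i\<le>n. y i) -` {x})"
    by (intro closed_vimage continuous_on_sum continuous_on_product_coordinates) auto
  then have T: "compact T"
    unfolding T_def using S by (rule compact_Int_closed[rotated])
  have trunc: "(\<lambda>i. if i \<le> n then y i else 0) \<in> T"
    if "\<And>i. i \<le> n \<Longrightarrow> y i \<in> \<Delta> i" "(\<Sum>i\<le>n. y i) = x" for y
    using that by (auto simp: T_def S_def)
  have "T \<noteq> {}"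
    using assms trunc unfolding mem_Minkowski_sum_iff by blast
  moreover have "continuous_on T (\<lambda>y. \<Sum>i\<le>n. f i (y i))"
  proof (intro continuous_on_sum)
    fix i assume "i \<in> {..n}"
    then have i: "i \<le> n" by simp
    have "(\<lambda>y. y i) ` T \<subseteq> \<Delta> i" using i by (auto simp: T_def S_def PiE_iff split: if_splits)
    then show "continuous_on T (\<lambda>y. f i (y i))"
      by (rule continuous_on_compose2[OF continuous_f[OF i]
          continuous_on_subset[OF continuous_on_product_coordinates subset_UNIV]])
  qed
  ultimately obtain y where y: "y \<in> T" "\<And>z. z \<in> T \<Longrightarrow> (\<Sum>i\<le>n. f i (y i)) \<le> (\<Sum>i\<le>n. f i (z i))"
    using continuous_attains_inf[OF T, of "\<lambda>y. \<Sum>i\<le>n. f i (y i)"] by blast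
  have y1: "y i \<in> \<Delta> i" if "i \<le> n" for i
    using y(1) that by (auto simp: T_def S_def PiE_iff split: if_splits)
  have y2: "(\<Sum>i\<le>n. y i) = x" using y(1) by (simp add: T_def)
  have min: "(\<Sum>i\<le>n. f i (y i)) \<le> (\<Sum>i\<le>n. f i (y' i))"
    if "\<And>i. i \<le> n \<Longrightarrow> y' i \<in> \<Delta> i" "(\<Sum>i\<le>n. y' i) = x" for y'
    using y(2)[OF trunc[OF that]] by simp
  have "conv_f x = (\<Sum>i\<le>n. f i (y i))"
    unfolding inf_convolution_def
  proof (rule cInf_eq_minimum)
    show "(\<Sum>i\<le>n. f i (y i)) \<in> {\<Sum>i\<le>n. f i (y i) |y. (\<forall>i\<le>n. y i \<in> \<Delta> i) \<and> (\<Sum>i\<le>n. y i) = x}"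
      using y1 y2 by blast
  qed (use min in auto)
  with that[OF y1 y2] min show ?thesis by simp
qed

lemma inf_convolution_le:
  assumes "\<And>i. i \<le> n \<Longrightarrow> y i \<in> \<Delta> i"
  shows "conv_f (\<Sum>i\<le>n. y i) \<le> (\<Sum>i\<le>n. f i (y i))"
proof -
  have "(\<Sum>i\<le>n. y i) \<in> total_dom" using assms mem_Minkowski_sum_iff by blast
  then show ?thesis
  proof (rule inf_convolution_attained)
    assume "\<And>y'. (\<And>i. i \<le> n \<Longrightarrow> y' i \<in> \<Delta> i) \<Longrightarrow> (\<Sum>i\<le>n. y' i) = (\<Sum>i\<le>n. y i)
      \<Longrightarrow> conv_f (\<Sum>i\<le>n. y i) \<le> (\<Sum>i\<le>n. f i (y' i))"
    from this[OF assms refl] show ?thesis by simp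
  qed
qed

lemma component_cell_nonempty: "linear v \<Longrightarrow> i \<le> n \<Longrightarrow> cell (\<Delta> i) (f i) v \<noteq> {}"
  using cell_nonempty[OF compact_dom dom_nonempty continuous_f] by blast

lemma component_cell_points:
  assumes "linear v"
  obtains z where "\<And>i. i \<le> n \<Longrightarrow> z i \<in> cell (\<Delta> i) (f i) v"
proof -
  have "\<exists>x. i \<le> n \<longrightarrow> x \<in> cell (\<Delta> i) (f i) v" for i
    using component_cell_nonempty[OF assms] by blast
  then show ?thesis using that by metis
qed

lemma convex_component_cell: "linear v \<Longrightarrow> i \<le> n \<Longrightarrow> convex (cell (\<Delta> i) (f i) v)"
  using convex_cell convex_f by blast

text \<open>Minimising \<open>\<Sum>i. f i (y i) + v (y i)\<close> decouples into one problem for each index.\<close>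

lemma sum_in_cell_iff:
  assumes v: "linear v" and y: "\<And>i. i \<le> n \<Longrightarrow> y i \<in> \<Delta> i"
  shows "(\<Sum>i\<le>n. y i) \<in> cell total_dom conv_f v \<and> conv_f (\<Sum>i\<le>n. y i) = (\<Sum>i\<le>n. f i (y i)) \<longleftrightarrow>
         (\<forall>i\<le>n. y i \<in> cell (\<Delta> i) (f i) v)"
proof -
  obtain z where z: "\<And>i. i \<le> n \<Longrightarrow> z i \<in> cell (\<Delta> i) (f i) v"
    using component_cell_points[OF v] by blast
  define m where "m = (\<Sum>i\<le>n. f i (z i) + v (z i))"
  have zD: "\<And>i. i \<le> n \<Longrightarrow> z i \<in> \<Delta> i" using z cell_subset by blast
  have total: "(\<Sum>i\<le>n. f i (x i)) + v (\<Sum>i\<le>n. x i) = (\<Sum>i\<le>n. f i (x i) + v (x i))" for x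
    using v by (simp add: linear_sum sum.distrib)
  have ge: "m \<le> (\<Sum>i\<le>n. f i (x i) + v (x i))" if "\<And>i. i \<le> n \<Longrightarrow> x i \<in> \<Delta> i" for x
    unfolding m_def using z that by (intro sum_mono) (auto simp: cell_def)
  have conv_ge: "m \<le> conv_f x + v x" if x: "x \<in> total_dom" for x
  proof -
    obtain p where "\<And>i. i \<le> n \<Longrightarrow> p i \<in> \<Delta> i" "(\<Sum>i\<le>n. p i) = x" "conv_f x = (\<Sum>i\<le>n. f i (p i))"
      using inf_convolution_attained[OF x] by blast
    then show ?thesis using ge[of p] total[of p] by simp
  qed
  have in_dom: "(\<Sum>i\<le>n. y i) \<in> total_dom" using y mem_Minkowski_sum_iff by blast
  show ?thesis
  proof
    assume L: "(\<Sum>i\<le>n. y i) \<in> cell total_dom conv_f v \<and> conv_f (\<Sum>i\<le>n. y i) = (\<Sum>i\<le>n. f i (y i))"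
    have "(\<Sum>i\<le>n. z i) \<in> total_dom" using zD mem_Minkowski_sum_iff by blast
    then have "(\<Sum>i\<le>n. f i (y i)) + v (\<Sum>i\<le>n. y i) \<le> conv_f (\<Sum>i\<le>n. z i) + v (\<Sum>i\<le>n. z i)"
      using L by (auto simp: cell_def)
    also have "\<dots> \<le> m"
      using inf_convolution_le[of z] zD total[of z] by (simp add: m_def)
    finally have le: "(\<Sum>i\<le>n. f i (y i) + v (y i)) \<le> m" using total by simp
    have each: "f i (z i) + v (z i) \<le> f i (y i) + v (y i)" if "i \<le> n" for i
      using z[OF that] y[OF that] by (auto simp: cell_def)
    have eq: "f i (y i) + v (y i) = f i (z i) + v (z i)" if "i \<le> n" for i
    proof (rule ccontr)
      assume "\<not> ?thesis"
      with each[OF that] have "f i (z i) + v (z i) < f i (y i) + v (y i)" by simp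
      then have "m < (\<Sum>i\<le>n. f i (y i) + v (y i))"
        unfolding m_def using each that by (intro sum_strict_mono_ex1) auto
      with le show False by simp
    qed
    show "\<forall>i\<le>n. y i \<in> cell (\<Delta> i) (f i) v"
      using z y eq by (simp add: cell_def)
  next
    assume R: "\<forall>i\<le>n. y i \<in> cell (\<Delta> i) (f i) v"
    have "(\<Sum>i\<le>n. f i (y i) + v (y i)) = m"
      unfolding m_def using R z by (intro sum.cong) (auto simp: cell_def intro: order_antisym)
    then have sum_m: "(\<Sum>i\<le>n. f i (y i)) + v (\<Sum>i\<le>n. y i) = m" using total by simp
    have eq: "conv_f (\<Sum>i\<le>n. y i) = (\<Sum>i\<le>n. f i (y i))"
      using inf_convolution_le[OF y] conv_ge[OF in_dom] sum_m by linarith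
    moreover have "(\<Sum>i\<le>n. y i) \<in> cell total_dom conv_f v"
      using in_dom conv_ge eq sum_m by (simp add: cell_def)
    ultimately show "(\<Sum>i\<le>n. y i) \<in> cell total_dom conv_f v
      \<and> conv_f (\<Sum>i\<le>n. y i) = (\<Sum>i\<le>n. f i (y i))" by blast
  qed
qed

lemma cell_inf_convolution:
  assumes v: "linear v"
  shows "cell total_dom conv_f v = (\<Sum>i\<le>n. cell (\<Delta> i) (f i) v)"
proof (intro set_eqI iffI)
  fix x assume x: "x \<in> cell total_dom conv_f v"
  then have "x \<in> total_dom" using cell_subset by blast
  then obtain y where y: "\<And>i. i \<le> n \<Longrightarrow> y i \<in> \<Delta> i" "(\<Sum>i\<le>n. y i) = x"
    "conv_f x = (\<Sum>i\<le>n. f i (y i))" using inf_convolution_attained by blast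
  then show "x \<in> (\<Sum>i\<le>n. cell (\<Delta> i) (f i) v)"
    using sum_in_cell_iff[OF v, of y] x unfolding mem_Minkowski_sum_iff by auto
next
  fix x assume "x \<in> (\<Sum>i\<le>n. cell (\<Delta> i) (f i) v)"
  then obtain y where y: "\<And>i. i \<le> n \<Longrightarrow> y i \<in> cell (\<Delta> i) (f i) v" "(\<Sum>i\<le>n. y i) = x"
    unfolding mem_Minkowski_sum_iff by auto
  then show "x \<in> cell total_dom conv_f v"
    using sum_in_cell_iff[OF v, of y] cell_subset by blast
qed

lemma component_cell:
  assumes v: "linear v" and i: "i \<le> n"
  shows "component n \<Delta> f (cell total_dom conv_f v) i = cell (\<Delta> i) (f i) v"
proof (intro set_eqI iffI)
  fix x assume "x \<in> component n \<Delta> f (cell total_dom conv_f v) i"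
  then obtain y where y: "x = y i" "\<And>j. j \<le> n \<Longrightarrow> y j \<in> \<Delta> j"
    "(\<Sum>i\<le>n. y i) \<in> cell total_dom conv_f v" "conv_f (\<Sum>i\<le>n. y i) = (\<Sum>i\<le>n. f i (y i))"
    unfolding component_def by blast
  then show "x \<in> cell (\<Delta> i) (f i) v"
    using sum_in_cell_iff[OF v, of y] i by blast
next
  fix x assume x: "x \<in> cell (\<Delta> i) (f i) v"
  obtain z where z: "\<And>i. i \<le> n \<Longrightarrow> z i \<in> cell (\<Delta> i) (f i) v"
    using component_cell_points[OF v] by blast
  define y where "y = z(i := x)"
  have y: "\<forall>j\<le>n. y j \<in> cell (\<Delta> j) (f j) v" using z x by (simp add: y_def)
  have yD: "y j \<in> \<Delta> j" if "j \<le> n" for j using y cell_subset that by blast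
  have "x = y i" by (simp add: y_def)
  then show "x \<in> component n \<Delta> f (cell total_dom conv_f v) i"
    using sum_in_cell_iff[OF v, of y] y yD unfolding component_def by blast
qed

lemma optimal_summand_in_component_cell:
  assumes "linear v" "\<And>i. i \<le> n \<Longrightarrow> y i \<in> \<Delta> i" "(\<Sum>i\<le>n. y i) \<in> cell total_dom conv_f v"
    "conv_f (\<Sum>i\<le>n. y i) = (\<Sum>i\<le>n. f i (y i))" "i \<le> n"
  shows "y i \<in> cell (\<Delta> i) (f i) v"
  using sum_in_cell_iff[OF assms(1), of y] assms by blast

lemma convex_on_inf_convolution: "convex_on total_dom conv_f"
proof (rule convex_onI)
  show "convex total_dom"
    using convex_f convex_on_imp_convex by (intro convex_set_sum) auto
next
  fix t :: real and x y assume t: "0 < t" "t < 1" and xy: "x \<in> total_dom" "y \<in> total_dom"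
  obtain p where p: "\<And>i. i \<le> n \<Longrightarrow> p i \<in> \<Delta> i" "(\<Sum>i\<le>n. p i) = x"
    "conv_f x = (\<Sum>i\<le>n. f i (p i))" using inf_convolution_attained[OF xy(1)] by blast
  obtain q where q: "\<And>i. i \<le> n \<Longrightarrow> q i \<in> \<Delta> i" "(\<Sum>i\<le>n. q i) = y"
    "conv_f y = (\<Sum>i\<le>n. f i (q i))" using inf_convolution_attained[OF xy(2)] by blast
  define r where "r = (\<lambda>i. (1 - t) *\<^sub>R p i + t *\<^sub>R q i)"
  have r: "r i \<in> \<Delta> i" if "i \<le> n" for i
    using convex_on_imp_convex[OF convex_f[OF that]] p(1)[OF that] q(1)[OF that] t
    by (simp add: r_def convexD)
  have "(\<Sum>i\<le>n. r i) = (1 - t) *\<^sub>R x + t *\<^sub>R y"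
    by (simp add: r_def sum.distrib p(2)[symmetric] q(2)[symmetric] scaleR_sum_right)
  then have "conv_f ((1 - t) *\<^sub>R x + t *\<^sub>R y) \<le> (\<Sum>i\<le>n. f i (r i))"
    using inf_convolution_le[OF r] by simp
  also have "\<dots> \<le> (\<Sum>i\<le>n. (1 - t) * f i (p i) + t * f i (q i))"
    unfolding r_def using convex_onD[OF convex_f] p(1) q(1) t by (intro sum_mono) auto
  also have "\<dots> = (1 - t) * conv_f x + t * conv_f y"
    by (simp add: p(3) q(3) sum.distrib sum_distrib_left)
  finally show "conv_f ((1 - t) *\<^sub>R x + t *\<^sub>R y) \<le> (1 - t) * conv_f x + t * conv_f y" .
qed

lemma mixed_subdivision_iff:
  "C \<in> mixed_subdivision n \<Delta> f \<longleftrightarrow> (\<exists>v. linear v \<and> C = cell total_dom conv_f v)"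
  by (auto simp: mixed_subdivision_def subdivision_def)

end

section \<open>Functions on lattice polytopes\<close>

lemma convex_piecewise_affine_imp_continuous_on:
  assumes "convex_piecewise_affine \<Delta> f"
  shows "continuous_on \<Delta> f"
proof -
  obtain P where P: "finite P" "\<Union>P = \<Delta>" "\<And>Q. Q \<in> P \<Longrightarrow> polytope Q"
    "\<And>Q. Q \<in> P \<Longrightarrow> \<exists>v c. linear v \<and> (\<forall>x\<in>Q. f x = v x + c)"
    using assms unfolding convex_piecewise_affine_def by blast
  have "continuous_on (\<Union>Q\<in>P. Q) f"
  proof (rule continuous_on_closed_Union[OF P(1)])
    show "closed Q" if "Q \<in> P" for Q
      using P(3)[OF that] by (simp add: polytope_imp_closed)
    show "continuous_on Q f" if Q: "Q \<in> P" for Q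
    proof -
      obtain v c where v: "linear v" "\<forall>x\<in>Q. f x = v x + c" using P(4)[OF Q] by blast
      have "continuous_on Q (\<lambda>x. v x + c)"
        using linear_imp_continuous_on[OF v(1)] by (intro continuous_intros)
      then show ?thesis using v(2) continuous_on_cong by force
    qed
  qed
  then show ?thesis using P(2) by simp
qed

text \<open>Let \<open>x\<close> be in the cell and write \<open>(x, f x)\<close> as a convex combination of lifted points. Each
  of them lies on or above the graph of \<open>f\<close>, so that a point with positive coefficient must itself
  be minimal.\<close>

lemma cell_spanned_if_defined_on:
  assumes A: "finite A" and f: "defined_on A f" and v: "linear v"
  shows "cell (convex hull A) f v \<subseteq> convex hull (A \<inter> cell (convex hull A) f v)"
proof
  fix x assume x: "x \<in> cell (convex hull A) f v"
  obtain \<nu> where \<nu>: "\<And>x. x \<in> convex hull A \<Longrightarrow> (x, f x) \<in> convex hull ((\<lambda>a. (a, \<nu> a)) ` A)"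
    "\<And>x z. x \<in> convex hull A \<Longrightarrow> (x, z) \<in> convex hull ((\<lambda>a. (a, \<nu> a)) ` A) \<Longrightarrow> f x \<le> z"
    using f unfolding defined_on_def by blast
  have le: "f a \<le> \<nu> a" if "a \<in> A" for a
    using \<nu>(2)[of a "\<nu> a"] that by (simp add: hull_inc)
  have xD: "x \<in> convex hull A" using x cell_subset by blast
  have inj: "inj_on (\<lambda>a. (a, \<nu> a)) A" by (auto simp: inj_on_def)
  obtain l where l: "\<And>p. p \<in> (\<lambda>a. (a, \<nu> a)) ` A \<Longrightarrow> 0 \<le> l p" "sum l ((\<lambda>a. (a, \<nu> a)) ` A) = 1"
    "(\<Sum>p\<in>(\<lambda>a. (a, \<nu> a)) ` A. l p *\<^sub>R p) = (x, f x)"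
    using \<nu>(1)[OF xD] A by (auto simp: convex_hull_finite)
  define k where "k = (\<lambda>a. l (a, \<nu> a))"
  have k: "\<And>a. a \<in> A \<Longrightarrow> 0 \<le> k a" "sum k A = 1"
    using l(1,2) inj by (auto simp: k_def sum.reindex)
  have pair: "(\<Sum>a\<in>A. (k a *\<^sub>R a, k a * \<nu> a)) = (x, f x)"
    using l(3) inj by (simp add: k_def sum.reindex)
  have kx: "(\<Sum>a\<in>A. k a *\<^sub>R a) = x" "(\<Sum>a\<in>A. k a * \<nu> a) = f x"
    using arg_cong[OF pair, of fst] arg_cong[OF pair, of snd] by (simp_all add: fst_sum snd_sum)
  have val: "f x + v x = (\<Sum>a\<in>A. k a * (\<nu> a + v a))"
  proof -
    have "v x = (\<Sum>a\<in>A. k a * v a)"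
      using v by (simp add: kx(1)[symmetric] linear_sum linear_scale)
    then show ?thesis by (simp add: kx(2)[symmetric] distrib_left sum.distrib)
  qed
  define m where "m = f x + v x"
  have m_le: "m \<le> f a + v a" if "a \<in> A" for a
    using x that by (auto simp: m_def cell_def hull_inc)
  have "(\<Sum>a\<in>A. k a * (\<nu> a + v a - m)) = (\<Sum>a\<in>A. k a * (\<nu> a + v a)) - sum k A * m"
    by (simp add: right_diff_distrib sum_subtractf sum_distrib_right)
  also have "\<dots> = 0" using val k(2) by (simp add: m_def)
  finally have "(\<Sum>a\<in>A. k a * (\<nu> a + v a - m)) = 0" .
  moreover have "0 \<le> k a * (\<nu> a + v a - m)" if "a \<in> A" for a
    using k(1)[OF that] le[OF that] m_le[OF that] by simp
  ultimately have zero: "k a * (\<nu> a + v a - m) = 0" if "a \<in> A" for a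
    using sum_nonneg_eq_0_iff[OF A, of "\<lambda>a. k a * (\<nu> a + v a - m)"] that by blast
  have minimal: "a \<in> cell (convex hull A) f v" if "a \<in> A" "k a \<noteq> 0" for a
  proof -
    have "f a + v a \<le> m" using zero[OF that(1)] le[OF that(1)] that(2) by simp
    then show ?thesis
      using x that(1) unfolding m_def cell_def by (auto simp: hull_inc intro: order_trans)
  qed
  define A' where "A' = A \<inter> cell (convex hull A) f v"
  have A': "finite A'" using A by (simp add: A'_def)
  have off: "\<forall>a\<in>A - A'. k a = 0" using minimal by (auto simp: A'_def)
  have "sum k A' = sum k A"
    using off A by (intro sum.mono_neutral_left) (auto simp: A'_def)
  moreover have "(\<Sum>a\<in>A'. k a *\<^sub>R a) = (\<Sum>a\<in>A. k a *\<^sub>R a)"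
    using off A by (intro sum.mono_neutral_left) (auto simp: A'_def)
  ultimately have "x \<in> convex hull A'"
    using k kx(1) unfolding convex_hull_finite[OF A'] by (auto simp: A'_def)
  then show "x \<in> convex hull (A \<inter> cell (convex hull A) f v)" by (simp add: A'_def)
qed

section \<open>Lattices and full-dimensional cells\<close>

lemma lattice_of_rank_dim:
  assumes "lattice_of_rank n M"
  shows "dim M = n"
proof -
  obtain B where B: "finite B" "independent B" "card B = n"
    "M = {\<Sum>b\<in>B. real_of_int (k b) *\<^sub>R b | k. True}"
    using assms unfolding lattice_of_rank_def by blast
  have "b \<in> M" if "b \<in> B" for b
  proof -
    have "(\<Sum>c\<in>B. real_of_int (if c = b then 1 else 0) *\<^sub>R c) = (\<Sum>c\<in>B. if c = b then c else 0)"
      by (intro sum.cong) auto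
    also have "\<dots> = b" using B(1) that by simp
    finally have "b = (\<Sum>c\<in>B. real_of_int (if c = b then 1 else 0) *\<^sub>R c)" by (rule sym)
    then show ?thesis unfolding B(4)
      by (intro CollectI exI[of _ "\<lambda>c. if c = b then 1 else 0"]) simp
  qed
  moreover have "M \<subseteq> span B"
    unfolding B(4) by (auto intro!: span_sum span_scale intro: span_base)
  ultimately have "span M = span B"
    using span_base by (metis span_eq subset_iff)
  then show ?thesis using B(2,3) dim_span_eq_card_independent by (metis dim_span)
qed

text \<open>The coordinates with respect to a lattice basis are linear, hence bounded on bounded sets.\<close>

lemma finite_bounded_Int_lattice:
  fixes M :: "'a::euclidean_space set"
  assumes "lattice_of_rank n M" and S: "bounded S"
  shows "finite (S \<inter> M)"
proof -
  obtain B where B: "finite B" "independent B"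
    "M = {\<Sum>b\<in>B. real_of_int (k b) *\<^sub>R b | k. True}"
    using assms unfolding lattice_of_rank_def by blast
  have "\<exists>g :: 'a \<Rightarrow> real. linear g \<and> (\<forall>c\<in>B. g c = (if c = b then 1 else 0))" for b
    using linear_independent_extend[OF B(2), of "\<lambda>c. if c = b then 1 else 0"] by blast
  then obtain g :: "'a \<Rightarrow> 'a \<Rightarrow> real" where
    g: "\<And>b. linear (g b)" "\<And>b c. c \<in> B \<Longrightarrow> g b c = (if c = b then 1 else 0)"
    by metis
  have coord: "g b (\<Sum>c\<in>B. real_of_int (k c) *\<^sub>R c) = real_of_int (k b)" if "b \<in> B" for b k
  proof -
    have "g b (\<Sum>c\<in>B. real_of_int (k c) *\<^sub>R c) = (\<Sum>c\<in>B. if c = b then real_of_int (k c) else 0)"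
      using g by (simp add: linear_sum linear_scale) (intro sum.cong, auto)
    also have "\<dots> = real_of_int (k b)" using B(1) that by simp
    finally show ?thesis .
  qed
  have "\<exists>R. \<forall>x\<in>S. \<bar>g b x\<bar> \<le> real_of_int R" for b
  proof -
    have "bounded (g b ` S)"
      using S g(1) by (intro bounded_linear_image) (auto simp: linear_conv_bounded_linear)
    then obtain r where "\<forall>y\<in>g b ` S. norm y \<le> r" unfolding bounded_iff by blast
    then show ?thesis
      by (intro exI[of _ "\<lceil>r\<rceil>"]) (force intro: order_trans[OF _ le_of_int_ceiling])
  qed
  then obtain R where R: "\<And>b x. x \<in> S \<Longrightarrow> \<bar>g b x\<bar> \<le> real_of_int (R b)" by metis
  define K where "K = PiE B (\<lambda>b. {- R b..R b})"
  have "S \<inter> M \<subseteq> (\<lambda>k. \<Sum>b\<in>B. real_of_int (k b) *\<^sub>R b) ` K"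
  proof
    fix x assume x: "x \<in> S \<inter> M"
    then obtain k where k: "x = (\<Sum>b\<in>B. real_of_int (k b) *\<^sub>R b)" using B(3) by blast
    have "k b \<in> {- R b..R b}" if b: "b \<in> B" for b
    proof -
      have "\<bar>real_of_int (k b)\<bar> \<le> real_of_int (R b)"
        using R[of x b] x coord[OF b, of k] k by simp
      then show ?thesis by auto
    qed
    then have "restrict k B \<in> K" by (simp add: K_def)
    moreover have "x = (\<Sum>b\<in>B. real_of_int (restrict k B b) *\<^sub>R b)"
      unfolding k by (intro sum.cong) auto
    ultimately show "x \<in> (\<lambda>k. \<Sum>b\<in>B. real_of_int (k b) *\<^sub>R b) ` K" by blast
  qed
  moreover have "finite K" unfolding K_def using B(1) by (intro finite_PiE) auto
  ultimately show ?thesis using finite_subset by blast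
qed

locale spanned_family = convex_family n \<Delta> f
  for n and \<Delta> :: "nat \<Rightarrow> 'a::euclidean_space set" and f +
  fixes M :: "'a set"
  assumes total_dom_subset: "total_dom \<subseteq> span M" and dim_M: "dim M = n"
begin

lemma mixed_subdivision_subset: "C \<in> mixed_subdivision n \<Delta> f \<Longrightarrow> C \<subseteq> total_dom"
  using cell_subset by (auto simp: mixed_subdivision_iff)

lemma aff_dim_le: "C \<subseteq> total_dom \<Longrightarrow> aff_dim C \<le> int n"
  using aff_dim_subset[OF order_trans[OF _ total_dom_subset]] by (simp add: aff_dim_subspace dim_M)

lemma convex_mixed_cell: "C \<in> mixed_subdivision n \<Delta> f \<Longrightarrow> convex C"
  using convex_cell convex_on_inf_convolution by (auto simp: mixed_subdivision_iff)

lemma cell_unique: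
  assumes "convex C" "C \<subseteq> D" "aff_dim C = int n" "x \<in> rel_interior C" "x \<in> D'"
    and D: "D \<in> mixed_subdivision n \<Delta> f" "D' \<in> mixed_subdivision n \<Delta> f"
  shows "D' = D"
proof -
  obtain u v where uv: "linear u" "D = cell total_dom conv_f u"
    "linear v" "D' = cell total_dom conv_f v"
    using D[unfolded mixed_subdivision_iff] by blast
  show ?thesis
    unfolding uv(2,4)
    using assms(1-5) uv total_dom_subset dim_M
    by (intro cell_unique_at_rel_interior_point[of C _ _ u M x v]) auto
qed

lemma n_cell_if_superset:
  assumes "D \<in> mixed_subdivision n \<Delta> f" "C \<subseteq> D" "aff_dim C = int n"
  shows "D \<in> n_cells n \<Delta> f"
  using aff_dim_subset[OF assms(2)] aff_dim_le[OF mixed_subdivision_subset[OF assms(1)]] assms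
  by (simp add: n_cells_def)

lemma component_eq_cell:
  assumes "linear v" "C = cell total_dom conv_f v" "i \<le> n"
  shows "component n \<Delta> f C i = cell (\<Delta> i) (f i) v"
  using component_cell assms by blast

lemma the_n_cell_at_rel_interior_point:
  assumes C: "C \<in> n_cells n \<Delta> f" and x: "x \<in> rel_interior C"
  shows "(THE C. C \<in> n_cells n \<Delta> f \<and> x \<in> C) = C"
proof (rule the_equality)
  show "C \<in> n_cells n \<Delta> f \<and> x \<in> C" using C x rel_interior_subset by blast
next
  fix C' assume "C' \<in> n_cells n \<Delta> f \<and> x \<in> C'"
  with C x cell_unique[of C C x C'] convex_mixed_cell show "C' = C" by (auto simp: n_cells_def)
qed

end

lemma mem_translate_iff: "b \<in> (+) \<delta> ` S \<longleftrightarrow> b - \<delta> \<in> S"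
  for \<delta> :: "'a::ab_group_add"
  by (auto simp: image_iff intro!: bexI[of _ "b - \<delta>"])

lemma cell_of_eqI:
  assumes "spanned_family n (hulls A) f M"
    and "C \<in> n_cells n (hulls A) f" "b - \<delta> \<in> rel_interior C"
  shows "cell_of n A f \<delta> b = C"
proof -
  interpret spanned_family n "hulls A" f M by fact
  show ?thesis
    unfolding cell_of_def mem_translate_iff using the_n_cell_at_rel_interior_point assms by blast
qed

section \<open>The rows of the Canny-Emiris matrix\<close>

locale lattice_supports =
  fixes n :: nat and M :: "'a::euclidean_space set" and A :: "nat \<Rightarrow> 'a set"
  assumes lattice: "lattice_of_rank n M"
    and supports: "i \<le> n \<Longrightarrow> finite (A i) \<and> A i \<noteq> {} \<and> A i \<subseteq> M"
begin

abbreviation total_polytope where "total_polytope \<equiv> \<Sum>i\<le>n. hulls A i"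

lemma total_polytope_eq_hull: "total_polytope = convex hull (\<Sum>i\<le>n. A i)"
  by (simp add: convex_hull_set_sum hulls_def)

lemma finite_support_sum: "finite (\<Sum>i\<le>n. A i)"
  using supports by (intro finite_set_sum) auto

lemma total_polytope_subset_span: "total_polytope \<subseteq> span M"
  unfolding total_polytope_eq_hull
proof (rule hull_minimal)
  show "(\<Sum>i\<le>n. A i) \<subseteq> span M"
  proof
    fix x assume "x \<in> (\<Sum>i\<le>n. A i)"
    then obtain y where y: "\<And>i. i \<le> n \<Longrightarrow> y i \<in> A i" "(\<Sum>i\<le>n. y i) = x"
      using mem_Minkowski_sum_iff[of x A n] by blast
    have "y i \<in> span M" if "i \<le> n" for i using y(1)[OF that] supports[OF that] span_base by blast
    then show "x \<in> span M" using y(2) by (auto intro: span_sum)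
  qed
qed (simp add: subspace_imp_convex)

lemma mem_index_set_iff: "b \<in> index_set n M A \<delta> \<longleftrightarrow> b \<in> M \<and> b - \<delta> \<in> total_polytope"
  by (auto simp: index_set_def mem_translate_iff)

lemma finite_index_set: "finite (index_set n M A \<delta>)"
proof -
  have "compact total_polytope"
    unfolding total_polytope_eq_hull using finite_support_sum by (rule finite_imp_compact_convex_hull)
  then have "bounded ((+) \<delta> ` total_polytope)"
    by (intro bounded_translation compact_imp_bounded)
  then show ?thesis
    unfolding index_set_def using finite_bounded_Int_lattice[OF lattice] by blast
qed

lemma spanned_familyI:
  assumes "\<And>i. i \<le> n \<Longrightarrow> convex_piecewise_affine (convex hull (A i)) (f i)"
  shows "spanned_family n (hulls A) f M"
proof unfold_locales
  fix i assume i: "i \<le> n"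
  show "compact (hulls A i)" "hulls A i \<noteq> {}"
    using supports[OF i] by (auto simp: hulls_def finite_imp_compact_convex_hull)
  show "continuous_on (hulls A i) (f i)"
    using convex_piecewise_affine_imp_continuous_on assms[OF i] by (simp add: hulls_def)
  show "convex_on (hulls A i) (f i)"
    using assms[OF i] by (simp add: hulls_def convex_piecewise_affine_def)
qed (use total_polytope_subset_span lattice_of_rank_dim[OF lattice] in auto)

end

locale canny_emiris_data = lattice_supports n M A
  for n M and A :: "nat \<Rightarrow> 'a::euclidean_space set" +
  fixes \<rho> :: "nat \<Rightarrow> 'a \<Rightarrow> real" and \<delta> :: 'a
  assumes \<rho>_piecewise_affine: "i \<le> n \<Longrightarrow> convex_piecewise_affine (convex hull (A i)) (\<rho> i)"
    and \<rho>_defined_on: "i \<le> n \<Longrightarrow> defined_on (A i) (\<rho> i)"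
    and tight_\<rho>: "tight n (hulls A) \<rho>"
    and generic_\<delta>: "generic n M (hulls A) \<rho> \<delta>"
begin

sublocale spanned_family n "hulls A" \<rho> M
  using spanned_familyI \<rho>_piecewise_affine by blast

lemma component_cell_spanned:
  assumes "linear v" "i \<le> n"
  shows "cell (hulls A i) (\<rho> i) v = convex hull (A i \<inter> cell (hulls A i) (\<rho> i) v)"
proof
  show "cell (hulls A i) (\<rho> i) v \<subseteq> convex hull (A i \<inter> cell (hulls A i) (\<rho> i) v)"
    unfolding hulls_def
    using cell_spanned_if_defined_on[OF _ \<rho>_defined_on assms(1)] supports assms(2) by blast
  show "convex hull (A i \<inter> cell (hulls A i) (\<rho> i) v) \<subseteq> cell (hulls A i) (\<rho> i) v"
    using convex_component_cell assms by (intro hull_minimal) auto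
qed

sublocale polyhedral: polyhedral_function total_dom "\<Sum>i\<le>n. A i" conv_f
proof
  show "convex_on total_dom conv_f" by (rule convex_on_inf_convolution)
  show "finite (\<Sum>i\<le>n. A i)" by (rule finite_support_sum)
  show "(\<Sum>i\<le>n. A i) \<subseteq> total_dom"
    unfolding total_polytope_eq_hull by (rule hull_subset)
  fix v :: "'a \<Rightarrow> real" assume v: "linear v"
  define W where "W = (\<lambda>i. A i \<inter> cell (hulls A i) (\<rho> i) v)"
  have eq: "cell total_dom conv_f v = (\<Sum>i\<le>n. cell (hulls A i) (\<rho> i) v)"
    by (rule cell_inf_convolution[OF v])
  obtain z where "\<And>i. i \<le> n \<Longrightarrow> z i \<in> cell (hulls A i) (\<rho> i) v"
    using component_cell_points[OF v] by blast
  then show "cell total_dom conv_f v \<noteq> {}"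
    unfolding eq using mem_Minkowski_sum_iff[of _ "\<lambda>i. cell (hulls A i) (\<rho> i) v" n] by blast
  have "(\<Sum>i\<le>n. cell (hulls A i) (\<rho> i) v) = (\<Sum>i\<le>n. convex hull (W i))"
    unfolding W_def using component_cell_spanned[OF v] by (intro sum.cong) auto
  then have "cell total_dom conv_f v = convex hull (\<Sum>i\<le>n. W i)"
    by (simp add: eq convex_hull_set_sum)
  moreover have "(\<Sum>i\<le>n. W i) \<subseteq> (\<Sum>i\<le>n. A i) \<inter> (\<Sum>i\<le>n. cell (hulls A i) (\<rho> i) v)"
    by (intro Int_greatest Minkowski_sum_mono) (auto simp: W_def)
  ultimately show "cell total_dom conv_f v \<subseteq> convex hull ((\<Sum>i\<le>n. A i) \<inter> cell total_dom conv_f v)"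
    using hull_mono eq by metis
qed

text \<open>A lattice point translated by \<open>-\<delta>\<close> avoids the skeleton. If it were on the relative boundary
  of the cell containing it, it would also be in the cell of a perturbed functional, which is
  contained in a hyperplane and hence belongs to the skeleton.\<close>

lemma index_set_point_in_n_cell:
  assumes "b \<in> index_set n M A \<delta>"
  obtains C where "C \<in> n_cells n (hulls A) \<rho>" "b - \<delta> \<in> rel_interior C"
proof -
  define x where "x = b - \<delta>"
  have xD: "x \<in> total_dom" and b: "b \<in> M" using assms by (auto simp: mem_index_set_iff x_def)
  have n_dim: "aff_dim C = int n" if C: "C \<in> mixed_subdivision n (hulls A) \<rho>" "x \<in> C" for C
  proof (rule ccontr)
    assume "aff_dim C \<noteq> int n"
    then have "aff_dim C \<le> int n - 1" using aff_dim_le[of C] mixed_subdivision_subset[OF C(1)] by simp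
    then have "x \<in> skeleton n (hulls A) \<rho>" using C unfolding skeleton_def by blast
    then have "b \<in> (+) \<delta> ` skeleton n (hulls A) \<rho>" by (simp add: mem_translate_iff x_def)
    with b generic_\<delta> show False unfolding generic_def by blast
  qed
  obtain v where v: "linear v" "x \<in> cell total_dom conv_f v"
    using polyhedral.subdivision_covers xD unfolding subdivision_def by blast
  have "x \<in> rel_interior (cell total_dom conv_f v)"
  proof (rule ccontr)
    assume "\<not> ?thesis"
    then obtain w :: "'a \<Rightarrow> real" and v' z where w: "linear w" "linear v'" "x \<in> cell total_dom conv_f v'"
      "\<And>y. y \<in> cell total_dom conv_f v' \<Longrightarrow> w y = w x" "z \<in> cell total_dom conv_f v" "w z \<noteq> w x"
      using polyhedral.boundary_point_in_smaller_cell[OF v] by blast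
    have "aff_dim (cell total_dom conv_f v') = int n"
      using n_dim w(2,3) mixed_subdivision_iff by blast
    then have "w y = 0" if "y \<in> span M" for y
      using linear_zero_on_span_if_const_on_full_dim[OF w(1) _ _ _ that,
          of "cell total_dom conv_f v'"] w(4) cell_subset[of total_dom conv_f v'] total_dom_subset dim_M
      by simp
    moreover have "z \<in> span M" "x \<in> span M"
      using w(5) xD cell_subset[of total_dom conv_f v] total_dom_subset by blast+
    ultimately show False using w(6) by simp
  qed
  moreover have "cell total_dom conv_f v \<in> n_cells n (hulls A) \<rho>"
    using n_dim v mixed_subdivision_iff by (auto simp: n_cells_def)
  ultimately show ?thesis using that x_def by blast
qed

lemma cell_of:
  assumes "b \<in> index_set n M A \<delta>"
  shows "cell_of n A \<rho> \<delta> b \<in> n_cells n (hulls A) \<rho>" "b - \<delta> \<in> rel_interior (cell_of n A \<rho> \<delta> b)"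
proof -
  obtain C where C: "C \<in> n_cells n (hulls A) \<rho>" "b - \<delta> \<in> rel_interior C"
    using index_set_point_in_n_cell[OF assms] by blast
  moreover have "cell_of n A \<rho> \<delta> b = C"
    using cell_of_eqI[OF _ C] spanned_family_axioms by blast
  ultimately show "cell_of n A \<rho> \<delta> b \<in> n_cells n (hulls A) \<rho>"
    "b - \<delta> \<in> rel_interior (cell_of n A \<rho> \<delta> b)" by auto
qed

text \<open>Among \<open>n + 1\<close> nonempty components whose dimensions add up to \<open>n\<close>, one is a point.\<close>

lemma row_index_row_point:
  assumes b: "b \<in> index_set n M A \<delta>"
  shows "row_index n A \<rho> \<delta> b \<le> n"
    and "component n (hulls A) \<rho> (cell_of n A \<rho> \<delta> b) (row_index n A \<rho> \<delta> b) = {row_point n A \<rho> \<delta> b}"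
    and "row_point n A \<rho> \<delta> b \<in> A (row_index n A \<rho> \<delta> b)"
proof -
  define C where "C = cell_of n A \<rho> \<delta> b"
  define I where "I = {i. i \<le> n \<and> aff_dim (component n (hulls A) \<rho> C i) = 0}"
  have C: "C \<in> n_cells n (hulls A) \<rho>" using cell_of[OF b] C_def by simp
  then obtain v where v: "linear v" "C = cell total_dom conv_f v"
    by (auto simp: n_cells_def mixed_subdivision_iff)
  have comp: "component n (hulls A) \<rho> C i = cell (hulls A i) (\<rho> i) v" if "i \<le> n" for i
    using component_eq_cell v that by blast
  have "I \<noteq> {}"
  proof
    assume "I = {}"
    have "1 \<le> aff_dim (component n (hulls A) \<rho> C i)" if i: "i \<le> n" for i
    proof -
      have "aff_dim (component n (hulls A) \<rho> C i) \<ge> 0"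
        using comp[OF i] component_cell_nonempty[OF v(1) i] using aff_dim_negative_iff not_less by metis
      moreover have "aff_dim (component n (hulls A) \<rho> C i) \<noteq> 0"
        using \<open>I = {}\<close> i by (auto simp: I_def)
      ultimately show ?thesis by simp
    qed
    then have "(\<Sum>i\<le>n. 1) \<le> (\<Sum>i\<le>n. aff_dim (component n (hulls A) \<rho> C i))"
      by (intro sum_mono) auto
    moreover have "(\<Sum>i\<le>n. aff_dim (component n (hulls A) \<rho> C i)) = int n"
      using tight_\<rho> C by (auto simp: tight_def)
    ultimately show False by simp
  qed
  moreover have "finite I" by (simp add: I_def)
  moreover have row: "row_index n A \<rho> \<delta> b = Max I"
    by (simp add: row_index_def I_def C_def)
  ultimately have "row_index n A \<rho> \<delta> b \<in> I" using Max_in by simp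
  then have i: "row_index n A \<rho> \<delta> b \<le> n"
    "aff_dim (component n (hulls A) \<rho> C (row_index n A \<rho> \<delta> b)) = 0" by (auto simp: I_def)
  then obtain a where a: "component n (hulls A) \<rho> C (row_index n A \<rho> \<delta> b) = {a}"
    by (auto simp: aff_dim_eq_0)
  then have pt: "row_point n A \<rho> \<delta> b = a" by (simp add: row_point_def C_def)
  show "row_index n A \<rho> \<delta> b \<le> n" by (rule i)
  show "component n (hulls A) \<rho> (cell_of n A \<rho> \<delta> b) (row_index n A \<rho> \<delta> b) = {row_point n A \<rho> \<delta> b}"
    using a pt C_def by simp
  have "cell (hulls A (row_index n A \<rho> \<delta> b)) (\<rho> (row_index n A \<rho> \<delta> b)) v = {a}"
    using comp[OF i(1)] a by simp
  then have "A (row_index n A \<rho> \<delta> b) \<inter> {a} \<noteq> {}"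
    using component_cell_spanned[OF v(1) i(1)] by (metis convex_hull_empty insert_not_empty)
  then show "row_point n A \<rho> \<delta> b \<in> A (row_index n A \<rho> \<delta> b)" using pt by blast
qed

end

section \<open>Coarser mixed subdivisions\<close>

lemma cell_restrict_eq:
  fixes f :: "'a::euclidean_space \<Rightarrow> real"
  assumes "cell \<Delta> f u \<noteq> {}" "cell \<Delta> f u \<subseteq> D" "D \<subseteq> \<Delta>"
  shows "cell D (restrict f D) u = cell \<Delta> f u"
proof -
  obtain x0 where x0: "x0 \<in> cell \<Delta> f u" using assms(1) by blast
  then have x0D: "x0 \<in> D" using assms(2) by blast
  show ?thesis
  proof (intro set_eqI iffI)
    fix x assume x: "x \<in> cell D (restrict f D) u"
    then have "x \<in> D" "f x + u x \<le> f x0 + u x0"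
      using x0D by (auto simp: cell_def)
    moreover have "f x0 + u x0 \<le> f y + u y" if "y \<in> \<Delta>" for y
      using x0 that by (auto simp: cell_def)
    ultimately show "x \<in> cell \<Delta> f u"
      using assms(3) by (force simp: cell_def)
  next
    fix x assume x: "x \<in> cell \<Delta> f u"
    then have "x \<in> D" using assms(2) by blast
    then show "x \<in> cell D (restrict f D) u"
      using x assms(3) by (auto simp: cell_def)
  qed
qed

lemma convex_on_restrict: "convex_on S f \<Longrightarrow> convex_on S (restrict f S)"
  unfolding convex_on_def by (auto dest: convexD)

locale coarsening = canny_emiris_data n M A \<rho> \<delta>
  for n M and A :: "nat \<Rightarrow> 'a::euclidean_space set" and \<rho> \<delta> +
  fixes \<phi> :: "nat \<Rightarrow> 'a \<Rightarrow> real"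
  assumes \<phi>_piecewise_affine: "i \<le> n \<Longrightarrow> convex_piecewise_affine (convex hull (A i)) (\<phi> i)"
    and coarser_\<phi>: "coarser n (hulls A) \<phi> \<rho>"
begin

sublocale phi: spanned_family n "hulls A" \<phi> M
  using spanned_familyI \<phi>_piecewise_affine by blast

text \<open>Coarseness provides a cell of \<open>S(\<phi>)\<close> that contains the cell of \<open>S(\<rho>)\<close> around \<open>b - \<delta>\<close>,
  with components. As \<open>b - \<delta>\<close> is a relative interior point of a full-dimensional cell, there is
  no other cell of \<open>S(\<phi>)\<close> through it.\<close>

lemma containing_cell:
  assumes b: "b \<in> index_set n M A \<delta>"
    and D: "D \<in> mixed_subdivision n (hulls A) \<phi>" "b - \<delta> \<in> D"
  shows "D \<in> n_cells n (hulls A) \<phi>" and "cell_of n A \<rho> \<delta> b \<subseteq> D"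
    and "i \<le> n \<Longrightarrow> component n (hulls A) \<rho> (cell_of n A \<rho> \<delta> b) i \<subseteq> component n (hulls A) \<phi> D i"
proof -
  define C where "C = cell_of n A \<rho> \<delta> b"
  have C: "C \<in> mixed_subdivision n (hulls A) \<rho>" "aff_dim C = int n" "b - \<delta> \<in> rel_interior C"
    using cell_of[OF b] by (auto simp: C_def n_cells_def)
  obtain D0 where D0: "D0 \<in> mixed_subdivision n (hulls A) \<phi>" "C \<subseteq> D0"
    "\<forall>i\<le>n. component n (hulls A) \<rho> C i \<subseteq> component n (hulls A) \<phi> D0 i"
    using coarser_\<phi> C(1) unfolding coarser_def by blast
  have eq: "D = D0"
    by (rule phi.cell_unique[OF convex_mixed_cell[OF C(1)] D0(2) C(2,3) D(2) D0(1) D(1)])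
  show "D \<in> n_cells n (hulls A) \<phi>"
    using phi.n_cell_if_superset[OF D0(1,2) C(2)] eq by simp
  show "cell_of n A \<rho> \<delta> b \<subseteq> D"
    using D0(2) eq C_def by simp
  show "i \<le> n \<Longrightarrow> component n (hulls A) \<rho> (cell_of n A \<rho> \<delta> b) i \<subseteq> component n (hulls A) \<phi> D i"
    using D0(3) eq C_def by simp
qed

lemma containing_cell_exists:
  assumes b: "b \<in> index_set n M A \<delta>"
  obtains D where "D \<in> n_cells n (hulls A) \<phi>" "b - \<delta> \<in> D"
proof -
  have C: "cell_of n A \<rho> \<delta> b \<in> mixed_subdivision n (hulls A) \<rho>"
    "b - \<delta> \<in> cell_of n A \<rho> \<delta> b"
    using cell_of[OF b] rel_interior_subset by (auto simp: n_cells_def)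
  then obtain D where D: "D \<in> mixed_subdivision n (hulls A) \<phi>" "cell_of n A \<rho> \<delta> b \<subseteq> D"
    using coarser_\<phi> unfolding coarser_def by blast
  then show ?thesis using that[of D] containing_cell(1)[OF b D(1)] C(2) by blast
qed

lemma containing_cell_unique:
  assumes b: "b \<in> index_set n M A \<delta>"
    and D: "D \<in> n_cells n (hulls A) \<phi>" "b - \<delta> \<in> D"
    and D': "D' \<in> n_cells n (hulls A) \<phi>" "b - \<delta> \<in> D'"
  shows "D' = D"
proof (rule phi.cell_unique[OF _ _ _ _ D'(2)])
  show DD: "D \<in> mixed_subdivision n (hulls A) \<phi>" "D' \<in> mixed_subdivision n (hulls A) \<phi>"
    using D(1) D'(1) by (auto simp: n_cells_def)
  show "cell_of n A \<rho> \<delta> b \<subseteq> D" by (rule containing_cell(2)[OF b DD(1) D(2)])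
  show "convex (cell_of n A \<rho> \<delta> b)" "aff_dim (cell_of n A \<rho> \<delta> b) = int n"
    "b - \<delta> \<in> rel_interior (cell_of n A \<rho> \<delta> b)"
    using cell_of[OF b] convex_mixed_cell by (auto simp: n_cells_def)
qed

subsection \<open>Weights of matrix entries\<close>

text \<open>
  Decompose \<open>b - \<delta>\<close>, a relative interior point of the cell \<open>C\<close>, into relative interior points
  \<open>x\<^sub>j\<close> of the components of \<open>C\<close>, where \<open>x\<^sub>i = row_point b\<close>. Replacing \<open>x\<^sub>i\<close> by \<open>a'\<close> gives a
  decomposition of \<open>b' - \<delta>\<close>, which bounds \<open>\<phi> (b' - \<delta>)\<close> from above; this is the inequality. If the
  new decomposition is also optimal, then \<open>x\<^sub>j\<close>, for \<open>j \<noteq> i\<close>, belongs to the component of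
  the \<open>\<phi>\<close>-cell \<open>D'\<close> of \<open>b' - \<delta>\<close> as well as to that of the \<open>\<phi>\<close>-cell \<open>D\<close> of \<open>b - \<delta>\<close>. As \<open>x\<^sub>j\<close> is
  relatively interior, the functionals of \<open>D\<close> and \<open>D'\<close> differ by a constant on each \<open>C\<^sub>j\<close>, hence on
  the full-dimensional \<open>C\<close>, and \<open>D = D'\<close>.
\<close>

lemma entry_weight:
  fixes b b' :: 'a
  defines "i \<equiv> row_index n A \<rho> \<delta> b" and "a \<equiv> row_point n A \<rho> \<delta> b"
  defines "a' \<equiv> b' - b + a"
  assumes b: "b \<in> index_set n M A \<delta>" and b': "b' \<in> index_set n M A \<delta>"
    and a': "a' \<in> A i"
    and D: "D \<in> n_cells n (hulls A) \<phi>" "b - \<delta> \<in> D"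
  shows entry_weight_ge: "phi.conv_f (b' - \<delta>) - phi.conv_f (b - \<delta>) \<le> \<phi> i a' - \<phi> i a"
    and entry_weight_eq_iff: "phi.conv_f (b' - \<delta>) - phi.conv_f (b - \<delta>) = \<phi> i a' - \<phi> i a
           \<longleftrightarrow> a' \<in> component n (hulls A) \<phi> D i"
    and entry_in_block: "a' \<in> component n (hulls A) \<phi> D i \<Longrightarrow> b' - \<delta> \<in> D"
proof -
  define C where "C = cell_of n A \<rho> \<delta> b"
  have C: "C \<in> mixed_subdivision n (hulls A) \<rho>" "aff_dim C = int n" "b - \<delta> \<in> rel_interior C"
    using cell_of[OF b] by (auto simp: C_def n_cells_def)
  have i: "i \<le> n" and comp_i: "component n (hulls A) \<rho> C i = {a}"
    using row_index_row_point[OF b] by (auto simp: i_def a_def C_def)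
  obtain u where u: "linear u" "C = cell total_dom conv_f u"
    using C(1) by (auto simp: mixed_subdivision_iff)
  define Cc where "Cc = (\<lambda>j. cell (hulls A j) (\<rho> j) u)"
  have C_sum: "C = (\<Sum>j\<le>n. Cc j)"
    unfolding u(2) Cc_def by (rule cell_inf_convolution[OF u(1)])
  have Cc: "Cc j = component n (hulls A) \<rho> C j" if "j \<le> n" for j
    using component_eq_cell[OF u that] by (simp add: Cc_def)
  have convex_Cc: "convex (Cc j)" if "j \<le> n" for j
    unfolding Cc_def using convex_component_cell[OF u(1) that] .
  have Cc_i: "Cc i = {a}" using Cc[OF i] comp_i by simp
  have "rel_interior C = (\<Sum>j\<le>n. rel_interior (Cc j))"
    unfolding C_sum using convex_Cc by (intro rel_interior_sum_gen) auto
  then obtain x where x: "\<And>j. j \<le> n \<Longrightarrow> x j \<in> rel_interior (Cc j)" "(\<Sum>j\<le>n. x j) = b - \<delta>"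
    using C(3) mem_Minkowski_sum_iff[of "b - \<delta>" "\<lambda>j. rel_interior (Cc j)" n] by auto
  have x_Cc: "x j \<in> Cc j" if "j \<le> n" for j
    using x(1)[OF that] rel_interior_subset by blast
  have x_i: "x i = a" using x_Cc[OF i] Cc_i by simp
  obtain v where v: "linear v" "D = cell total_dom phi.conv_f v"
    using D(1) by (auto simp: n_cells_def phi.mixed_subdivision_iff)
  have D_comp: "component n (hulls A) \<phi> D j = cell (hulls A j) (\<phi> j) v" if "j \<le> n" for j
    by (rule phi.component_eq_cell[OF v that])
  have Dm: "D \<in> mixed_subdivision n (hulls A) \<phi>" using D(1) by (simp add: n_cells_def)
  have Cc_sub: "Cc j \<subseteq> cell (hulls A j) (\<phi> j) v" if "j \<le> n" for j
    using containing_cell(3)[OF b Dm D(2) that] D_comp[OF that] Cc[OF that] C_def by simp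
  have xD: "x j \<in> cell (hulls A j) (\<phi> j) v" if "j \<le> n" for j
    using x_Cc[OF that] Cc_sub[OF that] by blast
  have conv_b: "phi.conv_f (b - \<delta>) = (\<Sum>j\<le>n. \<phi> j (x j))"
    using phi.sum_in_cell_iff[OF v(1), of x] xD x(2) cell_subset by (metis subsetD)
  define y where "y = x(i := a')"
  have a'_hull: "a' \<in> hulls A i" using a' by (simp add: hulls_def hull_inc)
  have y_hull: "y j \<in> hulls A j" if "j \<le> n" for j
    using xD[OF that] a'_hull cell_subset by (auto simp: y_def)
  have split: "(\<Sum>j\<le>n. g j (y j)) = (\<Sum>j\<le>n. g j (x j)) - g i a + g i a'"
    for g :: "nat \<Rightarrow> 'a \<Rightarrow> 'c::ab_group_add"
  proof -
    have "(\<Sum>j\<in>{..n} - {i}. g j (y j)) = (\<Sum>j\<in>{..n} - {i}. g j (x j))"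
      by (intro sum.cong) (auto simp: y_def)
    then show ?thesis
      using i x_i by (simp add: sum.remove[of "{..n}" i] y_def)
  qed
  have y_sum: "(\<Sum>j\<le>n. y j) = b' - \<delta>"
    using split[of "\<lambda>_ z. z"] x(2) by (simp add: a'_def)
  have conv_y: "(\<Sum>j\<le>n. \<phi> j (y j)) = phi.conv_f (b - \<delta>) - \<phi> i a + \<phi> i a'"
    using split[of \<phi>] conv_b by simp
  show "phi.conv_f (b' - \<delta>) - phi.conv_f (b - \<delta>) \<le> \<phi> i a' - \<phi> i a"
    using phi.inf_convolution_le[OF y_hull] y_sum conv_y by simp
  have optimal: "b' - \<delta> \<in> D \<and> phi.conv_f (b' - \<delta>) = (\<Sum>j\<le>n. \<phi> j (y j))"
    if "a' \<in> component n (hulls A) \<phi> D i"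
  proof -
    have "\<forall>j\<le>n. y j \<in> cell (hulls A j) (\<phi> j) v"
      using xD that D_comp[OF i] by (simp add: y_def)
    then show ?thesis
      using phi.sum_in_cell_iff[OF v(1) y_hull] y_sum v(2) by simp
  qed
  then show "a' \<in> component n (hulls A) \<phi> D i \<Longrightarrow> b' - \<delta> \<in> D" by blast
  have same_cell: "a' \<in> component n (hulls A) \<phi> D i"
    if eq: "phi.conv_f (b' - \<delta>) = (\<Sum>j\<le>n. \<phi> j (y j))"
  proof -
    obtain D' where D': "D' \<in> n_cells n (hulls A) \<phi>" "b' - \<delta> \<in> D'"
      using containing_cell_exists[OF b'] by blast
    obtain v' where v': "linear v'" "D' = cell total_dom phi.conv_f v'"
      using D'(1) by (auto simp: n_cells_def phi.mixed_subdivision_iff)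
    have y_in: "y j \<in> cell (hulls A j) (\<phi> j) v'" if "j \<le> n" for j
      using phi.optimal_summand_in_component_cell[OF v'(1) y_hull _ _ that] y_sum D'(2) v'(2) eq
      by simp
    have agree: "v' z - v z = v' (x j) - v (x j)" if j: "j \<le> n" and z: "z \<in> Cc j" for j z
    proof (cases "j = i")
      case True
      then show ?thesis using z Cc_i x_i by simp
    next
      case False
      then have "x j \<in> cell (hulls A j) (\<phi> j) v'" using y_in[OF j] by (simp add: y_def)
      from functionals_agree_at_rel_interior_point[OF convex_Cc[OF j] Cc_sub[OF j] x(1)[OF j] this v(1) v'(1) z]
      show ?thesis .
    qed
    have agree_C: "v' z - v z = (\<Sum>j\<le>n. v' (x j) - v (x j))" if z: "z \<in> C" for z
    proof -
      obtain c where c: "\<And>j. j \<le> n \<Longrightarrow> c j \<in> Cc j" "(\<Sum>j\<le>n. c j) = z"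
        using z mem_Minkowski_sum_iff[of z Cc n] unfolding C_sum by auto
      have "v' z - v z = (\<Sum>j\<le>n. v' (c j) - v (c j))"
        using v(1) v'(1) by (simp add: c(2)[symmetric] linear_sum sum_subtractf)
      also have "\<dots> = (\<Sum>j\<le>n. v' (x j) - v (x j))"
        using agree c(1) by (intro sum.cong) auto
      finally show ?thesis .
    qed
    have "v' z - v z = 0" if "z \<in> span M" for z
    proof (rule linear_zero_on_span_if_const_on_full_dim[OF _ _ _ _ that])
      show "linear (\<lambda>z. v' z - v z)" using v(1) v'(1) by (intro linear_compose_sub)
      show "C \<subseteq> span M" using mixed_subdivision_subset[OF C(1)] total_dom_subset by blast
      show "aff_dim C = int (dim M)" using C(2) dim_M by simp
      show "v' p - v p = v' q - v q" if "p \<in> C" "q \<in> C" for p q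
        using agree_C that by simp
    qed
    then have "v' z = v z" if "z \<in> total_dom" for z using that total_dom_subset by force
    then have "D' = D" unfolding v(2) v'(2) by (auto simp: cell_def)
    moreover have "a' \<in> component n (hulls A) \<phi> D' i"
      using y_in[OF i] phi.component_eq_cell[OF v' i] by (simp add: y_def)
    ultimately show ?thesis by simp
  qed
  show "phi.conv_f (b' - \<delta>) - phi.conv_f (b - \<delta>) = \<phi> i a' - \<phi> i a
           \<longleftrightarrow> a' \<in> component n (hulls A) \<phi> D i"
    using optimal same_cell conv_y by (smt (verit))
qed

subsection \<open>Restriction to a cell of the coarser subdivision\<close>

text \<open>Every relative interior point of \<open>D\<close> lies in a cell of the finer subdivision, which is
  contained in some cell of the coarser one and thus in \<open>D\<close>. The finitely many closed cells of
  the finer subdivision contained in \<open>D\<close> then cover \<open>D\<close> as well.\<close>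

lemma n_cell_refined:
  assumes D: "D \<in> n_cells n (hulls A) \<phi>"
  shows "D = \<Union>{C \<in> mixed_subdivision n (hulls A) \<rho>. C \<subseteq> D \<and>
    (\<forall>i\<le>n. component n (hulls A) \<rho> C i \<subseteq> component n (hulls A) \<phi> D i)}" (is "D = \<Union>?R")
proof
  have Dm: "D \<in> mixed_subdivision n (hulls A) \<phi>" "aff_dim D = int n"
    using D by (auto simp: n_cells_def)
  have "rel_interior D \<subseteq> \<Union>?R"
  proof
    fix x assume x: "x \<in> rel_interior D"
    then have "x \<in> total_dom"
      using rel_interior_subset phi.mixed_subdivision_subset[OF Dm(1)] by blast
    then obtain C where C: "C \<in> mixed_subdivision n (hulls A) \<rho>" "x \<in> C"
      using polyhedral.subdivision_covers unfolding mixed_subdivision_def by blast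
    obtain D' where D': "D' \<in> mixed_subdivision n (hulls A) \<phi>" "C \<subseteq> D'"
      "\<forall>i\<le>n. component n (hulls A) \<rho> C i \<subseteq> component n (hulls A) \<phi> D' i"
      using coarser_\<phi> C(1) unfolding coarser_def by blast
    have "x \<in> D'" using C D' by blast
    have "D' = D"
      by (rule phi.cell_unique[OF phi.convex_mixed_cell[OF Dm(1)] subset_refl Dm(2) x \<open>x \<in> D'\<close>
            Dm(1) D'(1)])
    then show "x \<in> \<Union>?R" using C D' by blast
  qed
  moreover have "closed (\<Union>?R)"
  proof (rule closed_Union)
    show "finite ?R" using polyhedral.finite_subdivision unfolding mixed_subdivision_def by simp
    show "\<forall>C\<in>?R. closed C"
      using polyhedral.closed_subdivision_cell unfolding mixed_subdivision_def by blast
  qed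
  ultimately have "closure (rel_interior D) \<subseteq> \<Union>?R" by (rule closure_minimal)
  then show "D \<subseteq> \<Union>?R"
    using convex_closure_rel_interior[OF phi.convex_mixed_cell[OF Dm(1)]] closure_subset by blast
qed blast

lemma finite_n_cells: "finite (n_cells n (hulls A) \<phi>)"
proof (rule finite_subset)
  show "n_cells n (hulls A) \<phi> \<subseteq> Union ` Pow (mixed_subdivision n (hulls A) \<rho>)"
  proof
    fix D assume D: "D \<in> n_cells n (hulls A) \<phi>"
    show "D \<in> Union ` Pow (mixed_subdivision n (hulls A) \<rho>)"
      using n_cell_refined[OF D] by (rule image_eqI) blast
  qed
  show "finite (Union ` Pow (mixed_subdivision n (hulls A) \<rho>))"
    using polyhedral.finite_subdivision unfolding mixed_subdivision_def by simp
qed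

text \<open>
  A priori the pieces of \<open>\<phi> i\<close> could have vertices outside \<open>A i\<close>; the finer subdivision excludes it. If a
  vector \<open>p\<close> separates a point of the component \<open>D\<^sub>i\<close> from the hull of \<open>A i \<inter> D\<^sub>i\<close>, take minimisers
  \<open>z\<^sub>j\<close> of \<open>(\<bullet>) p\<close> on all components \<open>D\<^sub>j\<close>. Their sum lies in a cell of the finer subdivision inside
  \<open>D\<close>, so it also decomposes into points \<open>q\<^sub>j\<close> of the components of that cell, which are contained
  in the \<open>D\<^sub>j\<close>. Comparing the two decompositions gives \<open>p \<bullet> q\<^sub>i = p \<bullet> z\<^sub>i\<close>, although \<open>q\<^sub>i\<close> is in the hull
  of \<open>A i \<inter> D\<^sub>i\<close>.
\<close>

lemma component_eq_hull_of_supports: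
  assumes D: "D \<in> n_cells n (hulls A) \<phi>" and i: "i \<le> n"
  shows "hulls (restrict_supports n A \<phi> D) i = component n (hulls A) \<phi> D i"
proof -
  obtain v where v: "linear v" "D = cell total_dom phi.conv_f v"
    using D by (auto simp: n_cells_def phi.mixed_subdivision_iff)
  define Dc where "Dc = (\<lambda>j. cell (hulls A j) (\<phi> j) v)"
  have Dc: "component n (hulls A) \<phi> D j = Dc j" if "j \<le> n" for j
    unfolding Dc_def by (rule phi.component_eq_cell[OF v that])
  define E where "E = convex hull (A i \<inter> Dc i)"
  have "Dc i \<subseteq> E"
  proof (rule ccontr)
    assume "\<not> Dc i \<subseteq> E"
    then obtain x where x: "x \<in> Dc i" "x \<notin> E" by blast
    have "compact E"
      unfolding E_def using supports[OF i] by (intro finite_imp_compact_convex_hull) auto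
    then have "closed E" by (rule compact_imp_closed)
    moreover have "convex E" by (simp add: E_def)
    ultimately obtain p c where p: "p \<bullet> x < c" "\<And>z. z \<in> E \<Longrightarrow> c < p \<bullet> z"
      using separating_hyperplane_closed_point[of E x] x(2) by blast
    have "\<exists>z. j \<le> n \<longrightarrow> z \<in> Dc j \<and> (\<forall>y\<in>Dc j. p \<bullet> z \<le> p \<bullet> y)" for j
    proof (cases "j \<le> n")
      case True
      have "compact (Dc j)" "Dc j \<noteq> {}"
        unfolding Dc_def
        using compact_cell[OF phi.compact_dom[OF True] phi.continuous_f[OF True] v(1)]
          phi.component_cell_nonempty[OF v(1) True] by auto
      moreover have "continuous_on (Dc j) (\<lambda>y. p \<bullet> y)" by (intro continuous_intros)
      ultimately show ?thesis using continuous_attains_inf[of "Dc j" "\<lambda>y. p \<bullet> y"] by blast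
    qed auto
    then obtain z where z: "\<And>j. j \<le> n \<Longrightarrow> z j \<in> Dc j"
      "\<And>j y. j \<le> n \<Longrightarrow> y \<in> Dc j \<Longrightarrow> p \<bullet> z j \<le> p \<bullet> y" by metis
    have "D = (\<Sum>j\<le>n. Dc j)"
      unfolding v(2) Dc_def by (rule phi.cell_inf_convolution[OF v(1)])
    then have "(\<Sum>j\<le>n. z j) \<in> D" using z(1) mem_Minkowski_sum_iff by blast
    then obtain C where C: "C \<in> mixed_subdivision n (hulls A) \<rho>" "(\<Sum>j\<le>n. z j) \<in> C"
      "\<forall>j\<le>n. component n (hulls A) \<rho> C j \<subseteq> component n (hulls A) \<phi> D j"
      using n_cell_refined[OF D] by blast
    obtain u where u: "linear u" "C = cell total_dom conv_f u"
      using C(1) by (auto simp: mixed_subdivision_iff)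
    have Cc_sub: "cell (hulls A j) (\<rho> j) u \<subseteq> Dc j" if "j \<le> n" for j
      using C(3) that component_eq_cell[OF u that] Dc[OF that] by metis
    have "(\<Sum>j\<le>n. z j) \<in> (\<Sum>j\<le>n. cell (hulls A j) (\<rho> j) u)"
      using C(2) u(2) cell_inf_convolution[OF u(1)] by simp
    then obtain q where q: "\<And>j. j \<le> n \<Longrightarrow> q j \<in> cell (hulls A j) (\<rho> j) u"
      "(\<Sum>j\<le>n. q j) = (\<Sum>j\<le>n. z j)"
      using mem_Minkowski_sum_iff[of "\<Sum>j\<le>n. z j" "\<lambda>j. cell (hulls A j) (\<rho> j) u" n] by auto
    have q_ge: "p \<bullet> z j \<le> p \<bullet> q j" if "j \<le> n" for j
      using z(2)[OF that] q(1)[OF that] Cc_sub[OF that] by blast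
    have "q i \<in> convex hull (A i \<inter> cell (hulls A i) (\<rho> i) u)"
      using q(1)[OF i] component_cell_spanned[OF u(1) i] by blast
    also have "\<dots> \<subseteq> E"
      unfolding E_def using Cc_sub[OF i] by (intro hull_mono) blast
    finally have "c < p \<bullet> q i" using p(2) by blast
    moreover have "p \<bullet> z i < c" using z(2)[OF i x(1)] p(1) by simp
    ultimately have "p \<bullet> z i < p \<bullet> q i" by simp
    then have "(\<Sum>j\<le>n. p \<bullet> z j) < (\<Sum>j\<le>n. p \<bullet> q j)"
      using q_ge i by (intro sum_strict_mono_ex1) auto
    moreover have "(\<Sum>j\<le>n. p \<bullet> q j) = (\<Sum>j\<le>n. p \<bullet> z j)"
      using q(2) by (simp flip: inner_sum_right)
    ultimately show False by simp
  qed
  moreover have "E \<subseteq> Dc i"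
    unfolding E_def Dc_def using phi.convex_component_cell[OF v(1) i] by (intro hull_minimal) auto
  ultimately show ?thesis
    using Dc[OF i] by (simp add: hulls_def restrict_supports_def E_def)
qed

lemma restricted_spanned_family:
  assumes D: "D \<in> n_cells n (hulls A) \<phi>"
  shows "spanned_family n (hulls (restrict_supports n A \<phi> D)) (restrict_functions n A \<phi> \<rho> D) M"
proof -
  obtain v where v: "linear v" "D = cell total_dom phi.conv_f v"
    using D by (auto simp: n_cells_def phi.mixed_subdivision_iff)
  have hull: "hulls (restrict_supports n A \<phi> D) i = cell (hulls A i) (\<phi> i) v"
    "component n (hulls A) \<phi> D i = cell (hulls A i) (\<phi> i) v" if "i \<le> n" for i
    using component_eq_hull_of_supports[OF D that] phi.component_eq_cell[OF v that] by auto
  show ?thesis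
  proof unfold_locales
    fix i assume i: "i \<le> n"
    show "compact (hulls (restrict_supports n A \<phi> D) i)"
      using compact_cell[OF phi.compact_dom[OF i] phi.continuous_f[OF i] v(1)] hull[OF i] by simp
    show "hulls (restrict_supports n A \<phi> D) i \<noteq> {}"
      using phi.component_cell_nonempty[OF v(1) i] hull[OF i] by simp
    have "continuous_on (cell (hulls A i) (\<phi> i) v) (\<rho> i)"
      using continuous_on_subset[OF continuous_f[OF i] cell_subset] .
    then show "continuous_on (hulls (restrict_supports n A \<phi> D) i) (restrict_functions n A \<phi> \<rho> D i)"
      unfolding restrict_functions_def hull[OF i] by (rule continuous_on_eq) simp
    have "convex_on (cell (hulls A i) (\<phi> i) v) (\<rho> i)"
      using convex_on_subset[OF convex_f[OF i] cell_subset] phi.convex_component_cell[OF v(1) i]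
      by blast
    then show "convex_on (hulls (restrict_supports n A \<phi> D) i) (restrict_functions n A \<phi> \<rho> D i)"
      unfolding restrict_functions_def hull[OF i]
      by (rule convex_on_restrict)
  next
    have "(\<Sum>i\<le>n. hulls (restrict_supports n A \<phi> D) i) \<subseteq> (\<Sum>i\<le>n. hulls A i)"
      using hull cell_subset by (intro Minkowski_sum_mono) simp
    then show "(\<Sum>i\<le>n. hulls (restrict_supports n A \<phi> D) i) \<subseteq> span M"
      using total_dom_subset by blast
    show "dim M = n" by (rule dim_M)
  qed
qed

text \<open>The components of the cell of \<open>S(\<rho>)\<close> around \<open>b - \<delta>\<close> are contained in those of \<open>D\<close>. Hence the
  functional defining this cell has the same minimisers after restriction, which gives the same
  cell with the same components.\<close>

lemma restricted_rows:
  assumes D: "D \<in> n_cells n (hulls A) \<phi>" and b: "b \<in> index_set n M A \<delta>" "b - \<delta> \<in> D"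
  defines "A' \<equiv> restrict_supports n A \<phi> D" and "\<rho>' \<equiv> restrict_functions n A \<phi> \<rho> D"
  shows "row_index n A' \<rho>' \<delta> b = row_index n A \<rho> \<delta> b"
    and "row_point n A' \<rho>' \<delta> b = row_point n A \<rho> \<delta> b"
proof -
  interpret R: spanned_family n "hulls A'" \<rho>' M
    unfolding A'_def \<rho>'_def by (rule restricted_spanned_family[OF D])
  define C where "C = cell_of n A \<rho> \<delta> b"
  have C: "C \<in> mixed_subdivision n (hulls A) \<rho>" "aff_dim C = int n" "b - \<delta> \<in> rel_interior C"
    using cell_of[OF b(1)] by (auto simp: C_def n_cells_def)
  obtain u where u: "linear u" "C = cell total_dom conv_f u"
    using C(1) by (auto simp: mixed_subdivision_iff)
  have Dm: "D \<in> mixed_subdivision n (hulls A) \<phi>" using D by (simp add: n_cells_def)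
  have D_sub: "component n (hulls A) \<phi> D i \<subseteq> hulls A i" if "i \<le> n" for i
    using that by (auto simp: component_def)
  have cell_eq: "cell (hulls A' i) (\<rho>' i) u = cell (hulls A i) (\<rho> i) u" if i: "i \<le> n" for i
    unfolding A'_def component_eq_hull_of_supports[OF D i] \<rho>'_def restrict_functions_def
  proof (rule cell_restrict_eq[OF component_cell_nonempty[OF u(1) i] _ D_sub[OF i]])
    show "cell (hulls A i) (\<rho> i) u \<subseteq> component n (hulls A) \<phi> D i"
      using containing_cell(3)[OF b(1) Dm b(2) i] component_eq_cell[OF u i] C_def by simp
  qed
  have "C = (\<Sum>i\<le>n. cell (hulls A' i) (\<rho>' i) u)"
    using cell_eq u(2) cell_inf_convolution[OF u(1)] by simp
  then have C': "C = cell R.total_dom R.conv_f u"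
    using R.cell_inf_convolution[OF u(1)] by simp
  then have "C \<in> n_cells n (hulls A') \<rho>'"
    using u(1) C(2) R.mixed_subdivision_iff by (auto simp: n_cells_def)
  then have cell_of': "cell_of n A' \<rho>' \<delta> b = C"
    using cell_of_eqI[OF R.spanned_family_axioms _ C(3)] by blast
  have comp: "component n (hulls A') \<rho>' C i = component n (hulls A) \<rho> C i" if "i \<le> n" for i
    using R.component_eq_cell[OF u(1) C' that] component_eq_cell[OF u that] cell_eq[OF that] by simp
  then have "{i. i \<le> n \<and> aff_dim (component n (hulls A') \<rho>' C i) = 0} =
    {i. i \<le> n \<and> aff_dim (component n (hulls A) \<rho> C i) = 0}" by auto
  then show row: "row_index n A' \<rho>' \<delta> b = row_index n A \<rho> \<delta> b"
    by (simp add: row_index_def cell_of' flip: C_def)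
  show "row_point n A' \<rho>' \<delta> b = row_point n A \<rho> \<delta> b"
    using comp[OF row_index_row_point(1)[OF b(1)]]
    by (simp add: row_point_def row cell_of' flip: C_def)
qed

end

section \<open>Principal minors of block diagonal matrices\<close>

lemma principal_minor_cong:
  assumes "\<And>b b'. b \<in> S \<Longrightarrow> b' \<in> S \<Longrightarrow> H b b' = K b b'"
  shows "principal_minor H S = principal_minor K S"
  unfolding principal_minor_def
  by (intro sum.cong arg_cong2[of _ _ _ _ "(*)"] prod.cong refl assms)
    (auto simp: permutes_in_image)

lemma permutes_combine:
  assumes "p permutes S" "q permutes R" "S \<inter> R = {}"
  shows "p \<circ> q permutes (S \<union> R)" "x \<in> S \<Longrightarrow> (p \<circ> q) x = p x" "x \<in> R \<Longrightarrow> (p \<circ> q) x = q x"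
proof -
  show "p \<circ> q permutes (S \<union> R)"
    using assms(1,2) by (intro permutes_compose) (auto intro: permutes_subset)
  show "x \<in> S \<Longrightarrow> (p \<circ> q) x = p x"
  proof -
    assume "x \<in> S"
    then have "q x = x" using assms(3) by (intro permutes_not_in[OF assms(2)]) blast
    then show ?thesis by simp
  qed
  show "x \<in> R \<Longrightarrow> (p \<circ> q) x = q x"
  proof -
    assume "x \<in> R"
    then have "q x \<notin> S" using assms(3) permutes_in_image[OF assms(2), of x] by blast
    then show ?thesis using permutes_not_in[OF assms(1)] by simp
  qed
qed

text \<open>A permutation with a nonzero term maps \<open>S\<close> into \<open>S\<close>. As \<open>S\<close> is finite, it then preserves both
  \<open>S\<close> and \<open>R\<close> and is a product of a permutation of \<open>S\<close> and one of \<open>R\<close>.\<close>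

lemma principal_minor_Un:
  fixes H :: "'a \<Rightarrow> 'a \<Rightarrow> 'r::comm_ring_1"
  assumes fin: "finite S" "finite R" and disj: "S \<inter> R = {}"
    and zero: "\<And>s r. s \<in> S \<Longrightarrow> r \<in> R \<Longrightarrow> H s r = 0"
  shows "principal_minor H (S \<union> R) = principal_minor H S * principal_minor H R"
proof -
  define t where "t = (\<lambda>U p. of_int (sign p) * (\<Prod>b\<in>U. H b (p b)))"
  have prod_combine: "t (S \<union> R) (p \<circ> q) = t S p * t R q"
    if p: "p permutes S" and q: "q permutes R" for p q
  proof -
    have "(\<Prod>b\<in>S \<union> R. H b ((p \<circ> q) b)) = (\<Prod>b\<in>S. H b ((p \<circ> q) b)) * (\<Prod>b\<in>R. H b ((p \<circ> q) b))"
      by (rule prod.union_disjoint[OF fin disj])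
    also have "(\<Prod>b\<in>S. H b ((p \<circ> q) b)) = (\<Prod>b\<in>S. H b (p b))"
      using permutes_combine(2)[OF p q disj] by (intro prod.cong) simp_all
    also have "(\<Prod>b\<in>R. H b ((p \<circ> q) b)) = (\<Prod>b\<in>R. H b (q b))"
      using permutes_combine(3)[OF p q disj] by (intro prod.cong) simp_all
    finally have "(\<Prod>b\<in>S \<union> R. H b ((p \<circ> q) b)) = (\<Prod>b\<in>S. H b (p b)) * (\<Prod>b\<in>R. H b (q b))" .
    moreover have "sign (p \<circ> q) = sign p * sign q"
      using p q fin by (intro sign_compose) (auto intro: permutes_imp_permutation)
    ultimately show ?thesis by (simp add: t_def mult_ac)
  qed
  have "principal_minor H (S \<union> R) = (\<Sum>f | f permutes (S \<union> R) \<and> f ` S = S. t (S \<union> R) f)"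
    unfolding principal_minor_def t_def
  proof (rule sum.mono_neutral_right)
    show "finite {f. f permutes (S \<union> R)}" using fin by (intro finite_permutations) simp
    show "\<forall>f\<in>{f. f permutes (S \<union> R)} - {f. f permutes (S \<union> R) \<and> f ` S = S}.
      of_int (sign f) * (\<Prod>b\<in>S \<union> R. H b (f b)) = 0"
    proof
      fix f assume "f \<in> {f. f permutes (S \<union> R)} - {f. f permutes (S \<union> R) \<and> f ` S = S}"
      then have f: "f permutes (S \<union> R)" "f ` S \<noteq> S" by auto
      have "\<not> f ` S \<subseteq> S"
        using f fin(1) permutes_inj[OF f(1)]
        by (metis card_image card_subset_eq inj_on_subset subset_UNIV)
      then obtain s where s: "s \<in> S" "f s \<notin> S" by blast
      have "f s \<in> S \<union> R" using permutes_in_image[OF f(1), of s] s(1) by blast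
      then have "H s (f s) = 0" using zero s by blast
      then have "(\<Prod>b\<in>S \<union> R. H b (f b)) = 0" using fin s(1) by (intro prod_zero) auto
      then show "of_int (sign f) * (\<Prod>b\<in>S \<union> R. H b (f b)) = 0" by simp
    qed
  qed auto
  also have "\<dots> = (\<Sum>(p, q) \<in> {p. p permutes S} \<times> {q. q permutes R}. t S p * t R q)"
  proof (rule sum.reindex_bij_witness[where j = "\<lambda>f. (restrict_id f S, restrict_id f R)"
        and i = "\<lambda>(p, q). p \<circ> q"])
    fix f assume "f \<in> {f. f permutes (S \<union> R) \<and> f ` S = S}"
    then have f: "f permutes (S \<union> R)" "f ` S = S" by auto
    have inj: "inj f" using f(1) by (rule permutes_inj)
    have "f ` (S \<union> R) = S \<union> R" using f(1) by (rule permutes_image)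
    then have R: "f ` R = R"
      using f(2) disj inj by (metis Diff_disjoint Int_commute Un_Diff_cancel Un_Diff Diff_triv
          image_set_diff Diff_cancel sup_bot.left_neutral)
    have bij: "bij_betw f S S" "bij_betw f R R"
      using inj f(2) R by (auto simp: bij_betw_def intro: inj_on_subset)
    have perm: "restrict_id f S permutes S" "restrict_id f R permutes R"
      using bij by (auto intro: permutes_restrict_id)
    then show "(restrict_id f S, restrict_id f R) \<in> {p. p permutes S} \<times> {q. q permutes R}" by simp
    have f_eq: "restrict_id f S \<circ> restrict_id f R = f"
    proof
      fix x
      show "(restrict_id f S \<circ> restrict_id f R) x = f x"
        using R disj permutes_not_in[OF f(1), of x] by (auto simp: restrict_id_def)
    qed
    then show "(case (restrict_id f S, restrict_id f R) of (p, q) \<Rightarrow> p \<circ> q) = f" by simp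
    show "(case (restrict_id f S, restrict_id f R) of (p, q) \<Rightarrow> t S p * t R q) = t (S \<union> R) f"
      using prod_combine[OF perm] f_eq by simp
  next
    fix pq assume "pq \<in> {p. p permutes S} \<times> {q. q permutes R}"
    then obtain p q where pq: "pq = (p, q)" "p permutes S" "q permutes R" by blast
    have "restrict_id (p \<circ> q) S = p" "restrict_id (p \<circ> q) R = q"
      using permutes_combine(2,3)[OF pq(2,3) disj] permutes_not_in[OF pq(2)] permutes_not_in[OF pq(3)]
      by (auto simp: restrict_id_def fun_eq_iff)
    then show "(restrict_id (case pq of (p, q) \<Rightarrow> p \<circ> q) S, restrict_id (case pq of (p, q) \<Rightarrow> p \<circ> q) R) = pq"
      by (simp add: pq(1))
    have "(p \<circ> q) ` S = p ` S"
      using permutes_combine(2)[OF pq(2,3) disj] by (intro image_cong) simp_all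
    also have "\<dots> = S" using permutes_image[OF pq(2)] .
    finally show "(case pq of (p, q) \<Rightarrow> p \<circ> q) \<in> {f. f permutes (S \<union> R) \<and> f ` S = S}"
      using permutes_combine(1)[OF pq(2,3) disj] by (simp add: pq(1))
  qed
  also have "\<dots> = principal_minor H S * principal_minor H R"
    unfolding principal_minor_def t_def by (simp add: sum_product sum.cartesian_product)
  finally show ?thesis .
qed

lemma principal_minor_UN_blocks:
  fixes H :: "'a \<Rightarrow> 'a \<Rightarrow> 'r::comm_ring_1"
  assumes "finite I" and "\<And>D. D \<in> I \<Longrightarrow> finite (S D)"
    and "\<And>D D'. D \<in> I \<Longrightarrow> D' \<in> I \<Longrightarrow> D \<noteq> D' \<Longrightarrow> S D \<inter> S D' = {}"
    and "\<And>D D' b b'. D \<in> I \<Longrightarrow> D' \<in> I \<Longrightarrow> D \<noteq> D' \<Longrightarrow> b \<in> S D \<Longrightarrow> b' \<in> S D' \<Longrightarrow> H b b' = 0"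
  shows "principal_minor H (\<Union>D\<in>I. S D) = (\<Prod>D\<in>I. principal_minor H (S D))"
  using assms
proof (induction I rule: finite_induct)
  case empty
  show ?case by (simp add: principal_minor_def)
next
  case (insert D I)
  have "principal_minor H (S D \<union> (\<Union>D\<in>I. S D)) = principal_minor H (S D) * principal_minor H (\<Union>D\<in>I. S D)"
  proof (rule principal_minor_Un)
    show "finite (S D)" "finite (\<Union>D\<in>I. S D)"
      using insert.hyps(1) insert.prems(1) by auto
    show "S D \<inter> (\<Union>D\<in>I. S D) = {}"
      using insert.prems(2) insert.hyps(2) by fastforce
    show "H s r = 0" if "s \<in> S D" "r \<in> (\<Union>D\<in>I. S D)" for s r
      using that insert.prems(3) insert.hyps(2) by blast
  qed
  also have "principal_minor H (\<Union>D\<in>I. S D) = (\<Prod>D\<in>I. principal_minor H (S D))"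
    by (rule insert.IH; rule insert.prems; simp)
  finally show ?case using insert.hyps by simp
qed

section \<open>Orders and initial parts of signed sums of monomials\<close>

lemma weight_superset:
  assumes "finite K" "Poly_Mapping.keys c \<subseteq> K"
  shows "weight \<omega> c = (\<Sum>k\<in>K. \<omega> k * real (Poly_Mapping.lookup c k))"
  unfolding weight_def using assms by (intro sum.mono_neutral_left) (auto simp: in_keys_iff)

lemma weight_add: "weight \<omega> (c + d) = weight \<omega> c + weight \<omega> d"
proof -
  define K where "K = Poly_Mapping.keys c \<union> Poly_Mapping.keys d"
  have K: "finite K" "Poly_Mapping.keys (c + d) \<subseteq> K" "Poly_Mapping.keys c \<subseteq> K"
    "Poly_Mapping.keys d \<subseteq> K"
    using keys_add[of c d] by (auto simp: K_def)
  show ?thesis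
    unfolding weight_superset[OF K(1,2)] weight_superset[OF K(1,3)] weight_superset[OF K(1,4)]
    by (simp add: lookup_add distrib_left sum.distrib)
qed

lemma weight_single [simp]: "weight \<omega> (Poly_Mapping.single k 1) = \<omega> k"
  by (simp add: weight_def)

lemma weight_sum: "weight \<omega> (\<Sum>b\<in>S. c b) = (\<Sum>b\<in>S. weight \<omega> (c b))"
proof (induction S rule: infinite_finite_induct)
  case (insert b S)
  then show ?case by (simp add: weight_add)
qed (simp_all add: weight_def)

lemma prod_u_var:
  "(\<Prod>b\<in>S. u_var (i b) (a b)) =
    Poly_Mapping.single (\<Sum>b\<in>S. Poly_Mapping.single (i b, a b) 1) (1 :: complex)"
  by (induction S rule: infinite_finite_induct) (auto simp: u_var_def mult_single)

lemma principal_minor_eq_sum_monomials: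
  assumes S: "finite S"
  shows "principal_minor (\<lambda>b b'. if Q b b' then u_var (i b) (a b b') else 0) S =
    (\<Sum>p | p permutes S \<and> (\<forall>b\<in>S. Q b (p b)).
       Poly_Mapping.single (\<Sum>b\<in>S. Poly_Mapping.single (i b, a b (p b)) 1) (of_int (sign p)))"
proof -
  have "principal_minor (\<lambda>b b'. if Q b b' then u_var (i b) (a b b') else 0) S =
    (\<Sum>p | p permutes S \<and> (\<forall>b\<in>S. Q b (p b)).
      of_int (sign p) * (\<Prod>b\<in>S. if Q b (p b) then u_var (i b) (a b (p b)) else 0))"
    unfolding principal_minor_def
  proof (rule sum.mono_neutral_right)
    show "finite {p. p permutes S}" by (rule finite_permutations[OF S])
    show "\<forall>p\<in>{p. p permutes S} - {p. p permutes S \<and> (\<forall>b\<in>S. Q b (p b))}.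
      of_int (sign p) * (\<Prod>b\<in>S. if Q b (p b) then u_var (i b) (a b (p b)) else 0) = 0"
    proof
      fix p assume "p \<in> {p. p permutes S} - {p. p permutes S \<and> (\<forall>b\<in>S. Q b (p b))}"
      then have "\<exists>b\<in>S. (if Q b (p b) then u_var (i b) (a b (p b)) else 0) = 0" by auto
      then have "(\<Prod>b\<in>S. if Q b (p b) then u_var (i b) (a b (p b)) else 0) = 0"
        by (rule prod_zero[OF S])
      then show "of_int (sign p) * (\<Prod>b\<in>S. if Q b (p b) then u_var (i b) (a b (p b)) else 0) = 0"
        by simp
    qed
  qed auto
  also have "\<dots> = (\<Sum>p | p permutes S \<and> (\<forall>b\<in>S. Q b (p b)).
       Poly_Mapping.single (\<Sum>b\<in>S. Poly_Mapping.single (i b, a b (p b)) 1) (of_int (sign p)))"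
  proof (rule sum.cong[OF refl])
    fix p assume "p \<in> {p. p permutes S \<and> (\<forall>b\<in>S. Q b (p b))}"
    then have "(\<Prod>b\<in>S. if Q b (p b) then u_var (i b) (a b (p b)) else 0) =
      (\<Prod>b\<in>S. u_var (i b) (a b (p b)))"
      by (intro prod.cong) auto
    also have "\<dots> = Poly_Mapping.single (\<Sum>b\<in>S. Poly_Mapping.single (i b, a b (p b)) 1) 1"
      by (rule prod_u_var)
    finally have prod: "(\<Prod>b\<in>S. if Q b (p b) then u_var (i b) (a b (p b)) else 0) =
      Poly_Mapping.single (\<Sum>b\<in>S. Poly_Mapping.single (i b, a b (p b)) 1) 1" .
    show "of_int (sign p) * (\<Prod>b\<in>S. if Q b (p b) then u_var (i b) (a b (p b)) else 0) =
      Poly_Mapping.single (\<Sum>b\<in>S. Poly_Mapping.single (i b, a b (p b)) 1) (of_int (sign p))"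
      unfolding prod single_of_int[symmetric] mult_single by simp
  qed
  finally show ?thesis .
qed

text \<open>The monomial of \<open>p\<^sub>0\<close> is not cancelled, so the minimal weight among the summands is attained
  by a monomial of the sum.\<close>

lemma ord_init_weight_sum_monomials:
  fixes e :: "'p \<Rightarrow> (nat \<times> 'a \<Rightarrow>\<^sub>0 nat)" and c :: "'p \<Rightarrow> complex"
  assumes P: "finite P" and p0: "p0 \<in> P" "c p0 \<noteq> 0"
    and le: "\<And>p. p \<in> P \<Longrightarrow> weight \<omega> (e p0) \<le> weight \<omega> (e p)"
    and unique: "\<And>p. p \<in> P \<Longrightarrow> e p = e p0 \<Longrightarrow> p = p0"
  defines "H \<equiv> \<Sum>p\<in>P. Poly_Mapping.single (e p) (c p)"
  shows "ord_weight \<omega> H = ereal (weight \<omega> (e p0))"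
    and "init_weight \<omega> H =
      (\<Sum>p | p \<in> P \<and> weight \<omega> (e p) = weight \<omega> (e p0). Poly_Mapping.single (e p) (c p))"
proof -
  define w where "w = weight \<omega> (e p0)"
  have lookup_H: "Poly_Mapping.lookup H d = (\<Sum>p\<in>P. c p when e p = d)" for d
    by (simp add: H_def lookup_sum lookup_single)
  have "(\<Sum>p\<in>P. c p when e p = e p0) = (\<Sum>p\<in>P. if p = p0 then c p0 else 0)"
    using unique by (intro sum.cong) (auto simp: when_def)
  then have "Poly_Mapping.lookup H (e p0) = c p0"
    using P p0(1) by (simp add: lookup_H)
  then have key: "e p0 \<in> Poly_Mapping.keys H" using p0(2) by (simp add: in_keys_iff)
  have keys: "\<exists>p\<in>P. d = e p" if d: "d \<in> Poly_Mapping.keys H" for d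
  proof (rule ccontr)
    assume "\<not> ?thesis"
    then have "Poly_Mapping.lookup H d = 0"
      unfolding lookup_H by (intro sum.neutral) (auto simp: when_def)
    with d show False by (simp add: in_keys_iff)
  qed
  have "Min (weight \<omega> ` Poly_Mapping.keys H) = w"
    unfolding w_def using key keys le by (intro Min_eqI) auto
  moreover have "H \<noteq> 0" using key by auto
  ultimately have ord: "ord_weight \<omega> H = ereal w" by (simp add: ord_weight_def)
  then show "ord_weight \<omega> H = ereal (weight \<omega> (e p0))" by (simp add: w_def)
  have "init_weight \<omega> H = (\<Sum>p | p \<in> P \<and> weight \<omega> (e p) = w. Poly_Mapping.single (e p) (c p))"
  proof (rule poly_mapping_eqI)
    fix d
    have "Poly_Mapping.lookup (init_weight \<omega> H) d =
      (\<Sum>d' | d' \<in> Poly_Mapping.keys H \<and> weight \<omega> d' = w.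
        if d' = d then Poly_Mapping.lookup H d else 0)"
      unfolding init_weight_def ord by (auto simp: lookup_sum lookup_single when_def intro!: sum.cong)
    also have "\<dots> = (if weight \<omega> d = w then Poly_Mapping.lookup H d else 0)"
      by (auto simp: in_keys_iff)
    also have "\<dots> = (\<Sum>p | p \<in> P \<and> weight \<omega> (e p) = w. c p when e p = d)"
    proof (cases "weight \<omega> d = w")
      case True
      then have "(\<Sum>p\<in>P. c p when e p = d) = (\<Sum>p | p \<in> P \<and> weight \<omega> (e p) = w. c p when e p = d)"
        using P by (intro sum.mono_neutral_right) (auto simp: when_def)
      with True show ?thesis by (simp add: lookup_H)
    next
      case False
      then have "(\<Sum>p | p \<in> P \<and> weight \<omega> (e p) = w. c p when e p = d) = 0"
        by (intro sum.neutral) (auto simp: when_def)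
      with False show ?thesis by simp
    qed
    also have "\<dots> = Poly_Mapping.lookup
      (\<Sum>p | p \<in> P \<and> weight \<omega> (e p) = w. Poly_Mapping.single (e p) (c p)) d"
      by (simp add: lookup_sum lookup_single)
    finally show "Poly_Mapping.lookup (init_weight \<omega> H) d = Poly_Mapping.lookup
      (\<Sum>p | p \<in> P \<and> weight \<omega> (e p) = w. Poly_Mapping.single (e p) (c p)) d" .
  qed
  then show "init_weight \<omega> H =
    (\<Sum>p | p \<in> P \<and> weight \<omega> (e p) = weight \<omega> (e p0). Poly_Mapping.single (e p) (c p))"
    by (simp add: w_def)
qed

section \<open>Initial parts of Canny-Emiris minors\<close>

context coarsening
begin

abbreviation ri where "ri \<equiv> row_index n A \<rho> \<delta>"
abbreviation rp where "rp \<equiv> row_point n A \<rho> \<delta>"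

text \<open>Summed over \<open>b \<in> S\<close>, the lower bounds for the weights of the entries telescope to zero, since
  a permutation of \<open>S\<close> does not change the sum of \<open>\<phi> (b - \<delta>)\<close>.\<close>

lemma permutation_weight:
  assumes S: "finite S" "S \<subseteq> index_set n M A \<delta>" and p: "p permutes S"
    and entries: "\<And>b. b \<in> S \<Longrightarrow> p b - b + rp b \<in> A (ri b)"
  shows permutation_weight_ge: "(\<Sum>b\<in>S. \<phi> (ri b) (rp b)) \<le> (\<Sum>b\<in>S. \<phi> (ri b) (p b - b + rp b))"
    and permutation_weight_eq_iff:
      "(\<Sum>b\<in>S. \<phi> (ri b) (p b - b + rp b)) = (\<Sum>b\<in>S. \<phi> (ri b) (rp b)) \<longleftrightarrow>
       (\<forall>b\<in>S. \<forall>D\<in>n_cells n (hulls A) \<phi>. b - \<delta> \<in> D \<longrightarrow>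
          p b - b + rp b \<in> component n (hulls A) \<phi> D (ri b))"
proof -
  define g where "g = (\<lambda>b. phi.conv_f (b - \<delta>))"
  define h where "h = (\<lambda>b. \<phi> (ri b) (p b - b + rp b) - \<phi> (ri b) (rp b) - (g (p b) - g b))"
  have "(\<Sum>b\<in>S. g (p b)) = (\<Sum>b\<in>S. g b)"
    using sum.permute[OF p, of g] by (simp add: comp_def)
  then have sum_h: "(\<Sum>b\<in>S. \<phi> (ri b) (p b - b + rp b)) = (\<Sum>b\<in>S. \<phi> (ri b) (rp b)) + (\<Sum>b\<in>S. h b)"
    by (simp add: h_def sum_subtractf)
  have pS: "p b \<in> index_set n M A \<delta>" "b \<in> index_set n M A \<delta>" if "b \<in> S" for b
    using that S(2) permutes_in_image[OF p] by auto
  have h_ge: "0 \<le> h b" if b: "b \<in> S" for b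
  proof -
    obtain D where D: "D \<in> n_cells n (hulls A) \<phi>" "b - \<delta> \<in> D"
      using containing_cell_exists[OF pS(2)[OF b]] by blast
    show ?thesis
      using entry_weight_ge[OF pS(2,1)[OF b] entries[OF b] D] by (simp add: h_def g_def)
  qed
  have h_eq: "h b = 0 \<longleftrightarrow> (\<forall>D\<in>n_cells n (hulls A) \<phi>. b - \<delta> \<in> D \<longrightarrow>
      p b - b + rp b \<in> component n (hulls A) \<phi> D (ri b))" if b: "b \<in> S" for b
  proof -
    have "h b = 0 \<longleftrightarrow> p b - b + rp b \<in> component n (hulls A) \<phi> D (ri b)"
      if D: "D \<in> n_cells n (hulls A) \<phi>" "b - \<delta> \<in> D" for D
      using entry_weight_eq_iff[OF pS(2,1)[OF b] entries[OF b] D] by (auto simp: h_def g_def)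
    then show ?thesis
      using containing_cell_exists[OF pS(2)[OF b]] by metis
  qed
  show "(\<Sum>b\<in>S. \<phi> (ri b) (rp b)) \<le> (\<Sum>b\<in>S. \<phi> (ri b) (p b - b + rp b))"
    using sum_h sum_nonneg[of S h] h_ge by simp
  show "(\<Sum>b\<in>S. \<phi> (ri b) (p b - b + rp b)) = (\<Sum>b\<in>S. \<phi> (ri b) (rp b)) \<longleftrightarrow>
       (\<forall>b\<in>S. \<forall>D\<in>n_cells n (hulls A) \<phi>. b - \<delta> \<in> D \<longrightarrow>
          p b - b + rp b \<in> component n (hulls A) \<phi> D (ri b))"
    using sum_h sum_nonneg_eq_0_iff[OF S(1) h_ge] h_eq by simp
qed

text \<open>Apply the preceding lemma to \<open>\<rho>\<close> itself: a permutation whose term has the weight of the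
  diagonal term only uses entries inside the cells of \<open>S(\<rho>)\<close>, where the only available point of
  the component is \<open>row_point b\<close>.\<close>

lemma permutation_eq_id_if_diagonal_weight:
  assumes S: "finite S" "S \<subseteq> index_set n M A \<delta>" and p: "p permutes S"
    and entries: "\<And>b. b \<in> S \<Longrightarrow> p b - b + rp b \<in> A (ri b)"
    and weight: "(\<Sum>b\<in>S. \<rho> (ri b) (p b - b + rp b)) = (\<Sum>b\<in>S. \<rho> (ri b) (rp b))"
  shows "p = id"
proof
  interpret self: coarsening n M A \<rho> \<delta> \<rho>
    by unfold_locales (auto simp: \<rho>_piecewise_affine coarser_def)
  fix b
  show "p b = id b"
  proof (cases "b \<in> S")
    case True
    then have b: "b \<in> index_set n M A \<delta>" using S(2) by blast
    have cell: "cell_of n A \<rho> \<delta> b \<in> n_cells n (hulls A) \<rho>" "b - \<delta> \<in> cell_of n A \<rho> \<delta> b"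
      using cell_of(1)[OF b] subsetD[OF rel_interior_subset cell_of(2)[OF b]] by auto
    have "p b - b + rp b \<in> component n (hulls A) \<rho> (cell_of n A \<rho> \<delta> b) (ri b)"
      using self.permutation_weight_eq_iff[OF S p entries] weight True cell by simp
    then show ?thesis using row_index_row_point(2)[OF b] by simp
  qed (use permutes_not_in[OF p] in auto)
qed

text \<open>
  The terms of the minor are signed monomials indexed by permutations. Those of minimal weight are
  the terms of the matrix \<open>T\<close>, in which only entries with \<open>a'\<close> in the component of the \<open>\<phi>\<close>-cell of
  \<open>b - \<delta>\<close> are kept. The diagonal term is one of them, and its monomial occurs only once, because it
  determines the \<open>\<rho>\<close>-weight of the permutation. The matrix \<open>T\<close> is block diagonal along the
  \<open>n\<close>-cells of \<open>S(\<phi>)\<close>, and its blocks are the Canny-Emiris matrices of the restricted data.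
\<close>

lemma ord_init_ce_minor:
  assumes \<omega>: "\<And>i a. i \<le> n \<Longrightarrow> a \<in> A i \<Longrightarrow> \<omega> (i, a) = \<phi> i a"
    and S: "S \<subseteq> index_set n M A \<delta>"
  shows "ord_weight \<omega> (ce_minor n A \<rho> \<delta> S) = ereal (\<Sum>b\<in>S. \<phi> (ri b) (rp b))"
    and "init_weight \<omega> (ce_minor n A \<rho> \<delta> S) =
      (\<Prod>D\<in>n_cells n (hulls A) \<phi>.
        ce_minor n (restrict_supports n A \<phi> D) (restrict_functions n A \<phi> \<rho> D) \<delta> (S \<inter> (+) \<delta> ` D))"
proof -
  have fin: "finite S" using S finite_index_set finite_subset by blast
  have row: "ri b \<le> n" "rp b \<in> A (ri b)" if "b \<in> S" for b
    using row_index_row_point that S by blast+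
  define Q where "Q = (\<lambda>b b'. b' - b + rp b \<in> A (ri b))"
  define Q' where "Q' = (\<lambda>b b'. Q b b' \<and> (\<forall>D\<in>n_cells n (hulls A) \<phi>. b - \<delta> \<in> D \<longrightarrow>
    b' - b + rp b \<in> component n (hulls A) \<phi> D (ri b)))"
  define T where "T = (\<lambda>b b'. if Q' b b' then u_var (ri b) (b' - b + rp b) else 0)"
  define P where "P = {p. p permutes S \<and> (\<forall>b\<in>S. Q b (p b))}"
  define e where "e = (\<lambda>p. \<Sum>b\<in>S. Poly_Mapping.single (ri b, p b - b + rp b) (1::nat))"
  define c where "c = (\<lambda>p :: 'a \<Rightarrow> 'a. of_int (sign p) :: complex)"
  have canny: "canny_emiris n A \<rho> \<delta> = (\<lambda>b b'. if Q b b' then u_var (ri b) (b' - b + rp b) else 0)"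
    by (simp add: canny_emiris_def Q_def Let_def fun_eq_iff)
  have minor: "ce_minor n A \<rho> \<delta> S = (\<Sum>p\<in>P. Poly_Mapping.single (e p) (c p))"
    unfolding ce_minor_def canny P_def e_def c_def by (rule principal_minor_eq_sum_monomials[OF fin])
  have P: "p permutes S" "\<And>b. b \<in> S \<Longrightarrow> p b - b + rp b \<in> A (ri b)" if "p \<in> P" for p
    using that by (auto simp: P_def Q_def)
  have weight_e: "weight \<omega> (e p) = (\<Sum>b\<in>S. \<phi> (ri b) (p b - b + rp b))" if "p \<in> P" for p
    unfolding e_def weight_sum weight_single using P(2)[OF that] row \<omega> by (intro sum.cong) auto
  have id: "id \<in> P" using row by (auto simp: P_def Q_def permutes_id)
  have weight_id: "weight \<omega> (e id) = (\<Sum>b\<in>S. \<phi> (ri b) (rp b))"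
    using weight_e[OF id] by simp
  have finP: "finite P" unfolding P_def using finite_permutations[OF fin] by simp
  have c_id: "c id \<noteq> 0" by (simp add: c_def)
  have ge: "weight \<omega> (e id) \<le> weight \<omega> (e p)" if "p \<in> P" for p
    using permutation_weight_ge[OF fin S P[OF that]] weight_e[OF that] weight_id by simp
  have unique: "p = id" if "p \<in> P" "e p = e id" for p
  proof (rule permutation_eq_id_if_diagonal_weight[OF fin S P[OF that(1)]])
    have "weight (\<lambda>(i, a). \<rho> i a) (e p) = weight (\<lambda>(i, a). \<rho> i a) (e id)" using that(2) by simp
    then show "(\<Sum>b\<in>S. \<rho> (ri b) (p b - b + rp b)) = (\<Sum>b\<in>S. \<rho> (ri b) (rp b))"
      unfolding e_def weight_sum weight_single by simp
  qed
  have ord_init: "ord_weight \<omega> (ce_minor n A \<rho> \<delta> S) = ereal (weight \<omega> (e id))"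
    "init_weight \<omega> (ce_minor n A \<rho> \<delta> S) =
      (\<Sum>p | p \<in> P \<and> weight \<omega> (e p) = weight \<omega> (e id). Poly_Mapping.single (e p) (c p))"
    unfolding minor by (rule ord_init_weight_sum_monomials[where P = P and ?p0.0 = id and c = c and e = e
          and \<omega> = \<omega>]; fact finP id c_id ge unique)+
  show "ord_weight \<omega> (ce_minor n A \<rho> \<delta> S) = ereal (\<Sum>b\<in>S. \<phi> (ri b) (rp b))"
    unfolding ord_init(1) weight_id by (rule refl)
  have min_iff: "weight \<omega> (e p) = weight \<omega> (e id) \<longleftrightarrow> (\<forall>b\<in>S. Q' b (p b))" if p: "p \<in> P" for p
  proof -
    have "\<forall>b\<in>S. Q b (p b)" using p by (simp add: P_def)
    moreover have "weight \<omega> (e p) = weight \<omega> (e id) \<longleftrightarrow>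
      (\<forall>b\<in>S. \<forall>D\<in>n_cells n (hulls A) \<phi>. b - \<delta> \<in> D \<longrightarrow>
         p b - b + rp b \<in> component n (hulls A) \<phi> D (ri b))"
      unfolding weight_e[OF p] weight_id by (rule permutation_weight_eq_iff[OF fin S P[OF p]])
    ultimately show ?thesis unfolding Q'_def by blast
  qed
  have "{p \<in> P. weight \<omega> (e p) = weight \<omega> (e id)} = {p. p permutes S \<and> (\<forall>b\<in>S. Q' b (p b))}"
  proof (intro set_eqI iffI)
    fix p assume "p \<in> {p \<in> P. weight \<omega> (e p) = weight \<omega> (e id)}"
    then show "p \<in> {p. p permutes S \<and> (\<forall>b\<in>S. Q' b (p b))}" using min_iff P(1) by blast
  next
    fix p assume p: "p \<in> {p. p permutes S \<and> (\<forall>b\<in>S. Q' b (p b))}"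
    then have "p \<in> P" by (simp add: P_def Q'_def)
    with p min_iff show "p \<in> {p \<in> P. weight \<omega> (e p) = weight \<omega> (e id)}" by blast
  qed
  then have init: "init_weight \<omega> (ce_minor n A \<rho> \<delta> S) = principal_minor T S"
    unfolding ord_init(2) T_def e_def c_def
    by (simp only: principal_minor_eq_sum_monomials[OF fin])
  have cover: "S = (\<Union>D\<in>n_cells n (hulls A) \<phi>. S \<inter> (+) \<delta> ` D)"
  proof (intro equalityI subsetI)
    fix b assume b: "b \<in> S"
    then obtain D where "D \<in> n_cells n (hulls A) \<phi>" "b - \<delta> \<in> D"
      using containing_cell_exists S by blast
    with b show "b \<in> (\<Union>D\<in>n_cells n (hulls A) \<phi>. S \<inter> (+) \<delta> ` D)"
      by (auto simp: mem_translate_iff)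
  qed auto
  have blocks: "principal_minor T (\<Union>D\<in>n_cells n (hulls A) \<phi>. S \<inter> (+) \<delta> ` D) =
    (\<Prod>D\<in>n_cells n (hulls A) \<phi>. principal_minor T (S \<inter> (+) \<delta> ` D))"
  proof (rule principal_minor_UN_blocks[OF finite_n_cells])
    show "finite (S \<inter> (+) \<delta> ` D)" for D using fin by simp
  next
    fix D D' assume D: "D \<in> n_cells n (hulls A) \<phi>" "D' \<in> n_cells n (hulls A) \<phi>" "D \<noteq> D'"
    show "(S \<inter> (+) \<delta> ` D) \<inter> (S \<inter> (+) \<delta> ` D') = {}"
    proof (rule equals0I)
      fix b assume "b \<in> (S \<inter> (+) \<delta> ` D) \<inter> (S \<inter> (+) \<delta> ` D')"
      then have "b \<in> index_set n M A \<delta>" "b - \<delta> \<in> D" "b - \<delta> \<in> D'"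
        using S by (auto simp: mem_translate_iff)
      then show False using containing_cell_unique D by blast
    qed
    fix b b' assume bb: "b \<in> S \<inter> (+) \<delta> ` D" "b' \<in> S \<inter> (+) \<delta> ` D'"
    then have b: "b \<in> index_set n M A \<delta>" "b' \<in> index_set n M A \<delta>" "b - \<delta> \<in> D" "b' - \<delta> \<in> D'"
      using S by (auto simp: mem_translate_iff)
    have "\<not> Q' b b'"
    proof
      assume "Q' b b'"
      then have "b' - b + rp b \<in> A (ri b)" "b' - b + rp b \<in> component n (hulls A) \<phi> D (ri b)"
        using D(1) b(3) by (auto simp: Q'_def Q_def)
      then have "b' - \<delta> \<in> D" using entry_in_block[OF b(1,2) _ D(1) b(3)] by blast
      then show False using containing_cell_unique[OF b(2) D(1) _ D(2) b(4)] D(3) by simp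
    qed
    then show "T b b' = 0" by (simp add: T_def)
  qed
  have restricted: "(\<Prod>D\<in>n_cells n (hulls A) \<phi>. principal_minor T (S \<inter> (+) \<delta> ` D)) =
      (\<Prod>D\<in>n_cells n (hulls A) \<phi>.
        ce_minor n (restrict_supports n A \<phi> D) (restrict_functions n A \<phi> \<rho> D) \<delta> (S \<inter> (+) \<delta> ` D))"
  proof (rule prod.cong[OF refl])
    fix D assume D: "D \<in> n_cells n (hulls A) \<phi>"
    show "principal_minor T (S \<inter> (+) \<delta> ` D) =
      ce_minor n (restrict_supports n A \<phi> D) (restrict_functions n A \<phi> \<rho> D) \<delta> (S \<inter> (+) \<delta> ` D)"
      unfolding ce_minor_def
    proof (rule principal_minor_cong)
      fix b b' assume "b \<in> S \<inter> (+) \<delta> ` D"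
      then have b: "b \<in> index_set n M A \<delta>" "b - \<delta> \<in> D" using S by (auto simp: mem_translate_iff)
      have "(\<forall>D'\<in>n_cells n (hulls A) \<phi>. b - \<delta> \<in> D' \<longrightarrow>
          b' - b + rp b \<in> component n (hulls A) \<phi> D' (ri b)) \<longleftrightarrow>
        b' - b + rp b \<in> component n (hulls A) \<phi> D (ri b)"
        using containing_cell_unique[OF b(1) D b(2)] D b(2) by blast
      then show "T b b' = canny_emiris n (restrict_supports n A \<phi> D) (restrict_functions n A \<phi> \<rho> D) \<delta> b b'"
        by (simp add: T_def Q'_def Q_def canny_emiris_def Let_def restricted_rows[OF D b]
            restrict_supports_def)
    qed
  qed
  show "init_weight \<omega> (ce_minor n A \<rho> \<delta> S) =
      (\<Prod>D\<in>n_cells n (hulls A) \<phi>.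
        ce_minor n (restrict_supports n A \<phi> D) (restrict_functions n A \<phi> \<rho> D) \<delta> (S \<inter> (+) \<delta> ` D))"
    using init arg_cong[OF cover, of "principal_minor T"] blocks restricted by (simp only:)
qed

end

theorem theorem4p10:
  fixes n :: nat
    and M :: "'a::euclidean_space set"
    and A :: "nat \<Rightarrow> 'a set"
    and \<rho> \<phi> :: "nat \<Rightarrow> 'a \<Rightarrow> real"
    and \<delta> :: 'a
    and \<omega> :: "nat \<times> 'a \<Rightarrow> real"
    and \<C> :: "'a set"
  assumes "lattice_of_rank n M"
    and "\<And>i. i \<le> n \<Longrightarrow> finite (A i) \<and> A i \<noteq> {} \<and> A i \<subseteq> M"
    and "\<And>i. i \<le> n \<Longrightarrow> convex_piecewise_affine (convex hull (A i)) (\<rho> i)"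
    and "\<And>i. i \<le> n \<Longrightarrow> defined_on (A i) (\<rho> i)"
    and "tight n (hulls A) \<rho>"
    and "\<delta> \<in> span M"
    and "generic n M (hulls A) \<rho> \<delta>"
    and "\<And>i. i \<le> n \<Longrightarrow> convex_piecewise_affine (convex hull (A i)) (\<phi> i)"
    and "coarser n (hulls A) \<phi> \<rho>"
    and "\<And>i a. i \<le> n \<Longrightarrow> a \<in> A i \<Longrightarrow> \<omega> (i, a) = \<phi> i a"
    and "\<C> \<subseteq> index_set n M A \<delta>"
  shows "ord_weight \<omega> (ce_minor n A \<rho> \<delta> \<C>) =
           ereal (\<Sum>b\<in>\<C>. \<phi> (row_index n A \<rho> \<delta> b) (row_point n A \<rho> \<delta> b)) \<and>
         init_weight \<omega> (ce_minor n A \<rho> \<delta> \<C>) =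
           (\<Prod>D \<in> n_cells n (hulls A) \<phi>.
              ce_minor n (restrict_supports n A \<phi> D) (restrict_functions n A \<phi> \<rho> D) \<delta>
                (\<C> \<inter> (+) \<delta> ` D))"
proof -
  interpret coarsening n M A \<rho> \<delta> \<phi>
    by unfold_locales (use assms in auto)
  show ?thesis
    using ord_init_ce_minor[OF assms(10,11)] by blast
qed

end
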